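(* The class of finitely discriminable groups and the class of isolated groups are both stable under: (1) extensions of groups: if $1\to K\to G\to Q\to 1$ is a short exact sequence of groups and $K$ and $Q$ are both finitely discriminable (resp. both isolated), then $G$ is finitely discriminable (resp. isolated); (2) taking overgroups of finite index: if $H$ is a finitely discriminable (resp. isolated) subgroup of finite index in a group $G$, then $G$ is finitely discriminable (resp. isolated).
   Context: A group $G$ is finitely discriminable if there exists a finite subset $F\subset G-\{1\}$ such that every non-trivial normal subgroup of $G$ contains at least one element of $F$. $F_m$ is the free group of rank $m$, and $\mathcal{G}_m$ is the set of normal subgroups of $F_m$ with the topology induced by the product topology on $\{0,1\}^{F_m}$. A group $G$ is isolated if it is finitely generated and, for some $m$ and some normal subgroup $N$ of $F_m$ with $F_m/N\cong G$, the point $N$ is isolated in $\mathcal{G}_m$ (this does not depend on the choice of $m$ and $N$). *)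

theory Defs
  imports "HOL-Analysis.Abstract_Topology" "HOL-Analysis.Function_Topology"
    "HOL-Algebra.Coset" "HOL-Algebra.Generated_Groups"
begin

section \<open>Free groups of finite rank\<close>

text \<open>
  The letter \<open>(k, True)\<close> stands for the \<open>k\<close>-th generator and \<open>(k, False)\<close> for its inverse.
  The free group of rank \<open>m\<close> is the group of reduced words over \<open>m\<close> generators,
  multiplied by concatenation followed by free reduction.
\<close>

type_synonym letter = "nat \<times> bool"

definition flip :: "letter \<Rightarrow> letter" where
  "flip x = (fst x, \<not> snd x)"

definition reduced :: "letter list \<Rightarrow> bool" where
  "reduced w \<longleftrightarrow> successively (\<lambda>x y. y \<noteq> flip x) w"

fun push :: "letter \<Rightarrow> letter list \<Rightarrow> letter list" where
  "push x [] = [x]"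
| "push x (y # w) = (if y = flip x then w else x # y # w)"

definition free_group :: "nat \<Rightarrow> letter list monoid" where
  "free_group m =
     \<lparr>carrier = {w \<in> lists ({..<m} \<times> UNIV). reduced w},
      mult = (\<lambda>u v. foldr push u v),
      one = []\<rparr>"

lemma flip_flip [simp]: "flip (flip x) = x"
  by (simp add: flip_def)

lemma flip_neq [simp]: "flip x \<noteq> x" "x \<noteq> flip x"
  by (auto simp: flip_def prod_eq_iff)

lemma reduced_Nil [simp]: "reduced []"
  by (simp add: reduced_def)

lemma reduced_Cons: "reduced (x # w) \<longleftrightarrow> reduced w \<and> (w \<noteq> [] \<longrightarrow> hd w \<noteq> flip x)"
  by (auto simp: reduced_def successively_Cons)

lemma reduced_push: "reduced w \<Longrightarrow> reduced (push x w)"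
  by (cases w) (auto simp: reduced_Cons)

lemma reduced_foldr_push: "reduced w \<Longrightarrow> reduced (foldr push u w)"
  by (induction u) (auto simp: reduced_push)

lemma push_reduced: "reduced (x # w) \<Longrightarrow> push x w = x # w"
  by (cases w) (auto simp: reduced_Cons)

lemma push_push_flip: "reduced w \<Longrightarrow> push x (push (flip x) w) = w"
  by (cases w) (auto simp: push_reduced)

lemma push_in_lists: "x \<in> A \<Longrightarrow> w \<in> lists A \<Longrightarrow> push x w \<in> lists A"
  by (cases w) auto

lemma foldr_push_in_lists: "u \<in> lists A \<Longrightarrow> w \<in> lists A \<Longrightarrow> foldr push u w \<in> lists A"
  by (induction u) (auto simp: push_in_lists simp del: in_lists_conv_set)

lemma foldr_push_push:
  assumes "reduced v" "reduced w"
  shows "foldr push (push x v) w = push x (foldr push v w)"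
proof (cases v)
  case (Cons y ys)
  show ?thesis
  proof (cases "y = flip x")
    case True
    then show ?thesis
      using Cons assms push_push_flip[OF reduced_foldr_push[OF assms(2)]] by simp
  qed (use Cons in simp)
qed simp

lemma foldr_push_assoc:
  assumes "reduced v" "reduced w"
  shows "foldr push (foldr push u v) w = foldr push u (foldr push v w)"
  by (induction u) (use assms in \<open>auto simp: foldr_push_push reduced_foldr_push\<close>)

lemma foldr_push_Nil: "reduced w \<Longrightarrow> foldr push w [] = w"
  by (induction w) (auto simp: reduced_Cons push_reduced)

lemma free_group_left_inverse:
  "w \<in> lists A \<Longrightarrow> (\<And>x. x \<in> A \<Longrightarrow> flip x \<in> A) \<Longrightarrow> reduced w \<Longrightarrow>
     \<exists>v \<in> lists A. reduced v \<and> foldr push v w = []"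
proof (induction w)
  case (Cons x w)
  then obtain v where v: "v \<in> lists A" "reduced v" "foldr push v w = []"
    by (auto simp: reduced_Cons)
  let ?v = "foldr push v [flip x]"
  have "foldr push ?v (x # w) = foldr push v (push (flip x) (x # w))"
    using foldr_push_assoc[of "[flip x]" "x # w" v] Cons.prems
    by (simp add: reduced_Cons)
  also have "\<dots> = []"
    using v by simp
  finally show ?case
    using Cons.prems v
    by (intro bexI[of _ ?v] conjI foldr_push_in_lists reduced_foldr_push)
       (auto simp: reduced_Cons)
qed (rule bexI[of _ "[]"], auto)

lemma group_free_group: "group (free_group m)"
proof (rule groupI)
  fix u assume "u \<in> carrier (free_group m)"
  then show "\<exists>v \<in> carrier (free_group m). v \<otimes>\<^bsub>free_group m\<^esub> u = \<one>\<^bsub>free_group m\<^esub>"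
    using free_group_left_inverse[of u "{..<m} \<times> UNIV"]
    unfolding free_group_def Bex_def by (simp add: flip_def mem_Times_iff)
qed (auto simp: free_group_def foldr_push_assoc reduced_foldr_push foldr_push_in_lists
       simp del: in_lists_conv_set)

lemma (in group) free_group_hom_extension:
  assumes "\<And>k. k < m \<Longrightarrow> f k \<in> carrier G"
  shows "\<exists>h \<in> hom (free_group m) G. \<forall>k<m. h [(k, True)] = f k"
proof -
  define g where "g x = (if snd x then f (fst x) else inv (f (fst x)))" for x :: letter
  define h where "h w = foldr (\<lambda>x a. g x \<otimes> a) w \<one>" for w
  let ?A = "{..<m} \<times> (UNIV :: bool set)"
  have g: "g x \<in> carrier G" if "x \<in> ?A" for x
    using that assms by (auto simp: g_def)
  have g_flip: "g x \<otimes> g (flip x) = \<one>" if "x \<in> ?A" for x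
    using that assms by (auto simp: g_def flip_def)
  have h: "h w \<in> carrier G" if "w \<in> lists ?A" for w
    using that by (induction w) (auto simp: h_def g)
  have h_push: "h (push x w) = g x \<otimes> h w" if "x \<in> ?A" "w \<in> lists ?A" for x w
  proof (cases w)
    case (Cons y ys)
    have *: "g x \<otimes> (g (flip x) \<otimes> h ys) = h ys" if "y = flip x"
    proof -
      have "flip x \<in> ?A" "ys \<in> lists ?A"
        using Cons \<open>w \<in> lists ?A\<close> \<open>y = flip x\<close> by auto
      then show ?thesis
        using \<open>x \<in> ?A\<close> by (simp add: g h g_flip flip: m_assoc del: in_lists_conv_set)
    qed
    then show ?thesis
      using Cons by (auto simp: h_def)
  qed (simp add: h_def)
  have h_mult: "h (foldr push u v) = h u \<otimes> h v" if "u \<in> lists ?A" "v \<in> lists ?A" for u v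
    using that(1)
  proof (induction u)
    case Nil
    then show ?case
      using h[OF that(2)] by (simp add: h_def)
  next
    case (Cons x u)
    then have "h (foldr push (x # u) v) = g x \<otimes> (h u \<otimes> h v)"
      using that(2) by (simp add: h_push foldr_push_in_lists del: in_lists_conv_set)
    also have "\<dots> = g x \<otimes> h u \<otimes> h v"
      using Cons that(2) by (intro m_assoc[symmetric] g h) auto
    finally show ?case
      by (simp add: h_def)
  qed
  have "h \<in> hom (free_group m) G"
    by (intro homI) (auto simp: free_group_def h h_mult simp del: in_lists_conv_set)
  moreover have "\<forall>k<m. h [(k, True)] = f k"
    using assms by (auto simp: h_def g_def)
  ultimately show ?thesis
    by blast
qed

section \<open>The space of normal subgroups and isolated groups\<close>

text \<open>A normal subgroup is identified with its indicator function on the carrier.\<close>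

definition normal_subgroups_topology :: "('a, 'b) monoid_scheme \<Rightarrow> 'a set topology" where
  "normal_subgroups_topology G =
     pullback_topology {N. N \<lhd> G} (\<lambda>N. \<lambda>x \<in> carrier G. x \<in> N)
       (product_topology (\<lambda>_. discrete_topology (UNIV :: bool set)) (carrier G))"

lemma topspace_normal_subgroups_topology:
  "topspace (normal_subgroups_topology G) = {N. N \<lhd> G}"
  by (auto simp: normal_subgroups_topology_def topspace_pullback_topology)

definition finitely_generated_group :: "('a, 'b) monoid_scheme \<Rightarrow> bool" where
  "finitely_generated_group G \<longleftrightarrow>
     group G \<and> (\<exists>S. finite S \<and> S \<subseteq> carrier G \<and> generate G S = carrier G)"

definition isolated_group :: "('a, 'b) monoid_scheme \<Rightarrow> bool" where
  "isolated_group G \<longleftrightarrow> finitely_generated_group G \<and>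
     (\<exists>m N. N \<lhd> free_group m \<and> free_group m Mod N \<cong> G \<and>
        openin (normal_subgroups_topology (free_group m)) {N})"

section \<open>Finitely discriminable groups and extensions\<close>

definition finitely_discriminable :: "('a, 'b) monoid_scheme \<Rightarrow> bool" where
  "finitely_discriminable G \<longleftrightarrow> group G \<and>
     (\<exists>F. finite F \<and> F \<subseteq> carrier G - {\<one>\<^bsub>G\<^esub>} \<and>
        (\<forall>N. N \<lhd> G \<and> N \<noteq> {\<one>\<^bsub>G\<^esub>} \<longrightarrow> N \<inter> F \<noteq> {}))"

text \<open>
  Unlike \<open>exact_seq\<close> from the library, this allows the three groups to live on different types.
\<close>

definition short_exact_sequence ::
  "('k, 'c) monoid_scheme \<Rightarrow> ('k \<Rightarrow> 'a) \<Rightarrow> ('a, 'b) monoid_scheme \<Rightarrow> ('a \<Rightarrow> 'q) \<Rightarrow>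
     ('q, 'd) monoid_scheme \<Rightarrow> bool" where
  "short_exact_sequence K i G p Q \<longleftrightarrow>
     group K \<and> group G \<and> group Q \<and> i \<in> mon K G \<and> p \<in> epi G Q \<and>
     i ` carrier K = kernel G Q p"

end

theory Submission
  imports Defs "HOL-Algebra.Elementary_Groups" "HOL-Algebra.SndIsomorphismGrp"
    "HOL-Algebra.Zassenhaus" "HOL-Computational_Algebra.Primes"
begin

text \<open>
  A group is isolated if and only if it is finitely presented and finitely discriminable
  (\<open>isolated_group_iff_finitely_presented_finitely_discriminable\<close>): a basic neighbourhood of a
  normal subgroup \<open>N\<close> of a free group prescribes finitely many elements that must lie in \<open>N\<close>
  and finitely many that must not; the former amount to finitely many relators, and the images
  of the latter in the quotient amount to a finite discriminating set. It therefore suffices to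
  show that each of the two properties passes to extensions and to overgroups of finite index.

  Finite discriminability. Let \<open>K\<close> be the given normal subgroup or the given subgroup of finite
  index. A normal subgroup of \<open>G\<close> that meets \<open>K\<close> non-trivially is detected inside \<open>K\<close>, so only
  normal subgroups \<open>N\<close> with \<open>N \<inter> K = {1}\<close> matter. They fall into finitely many classes,
  according to which discriminating element of the quotient, or which coset of \<open>K\<close>, they meet.
  In each class one member \<open>M\<close> is fixed, and any other member \<open>N\<close> is compared with it. For finite
  index, \<open>M\<close> is finite; either \<open>NM\<close> meets \<open>K\<close> trivially, and then \<open>N\<close> and \<open>M\<close> share an
  element, or \<open>NM\<close> contains one of finitely many \<open>a \<in> K\<close>, and then \<open>N\<close> contains some \<open>a m\<close>
  with \<open>m \<in> M\<close>. For an extension, either \<open>N \<inter> M\<close> is non-trivial and is detected in the quotient,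
  or elements \<open>n \<in> N\<close> and \<open>m \<in> M\<close> with the same image differ by an element \<open>z\<close> of the centre
  of \<open>K\<close>. The centre of a finitely discriminable group is a torsion group and has only finitely
  many elements of each exponent; this forces \<open>m\<close> to have finite order and \<open>z\<close> to have
  exponent dividing it, which leaves finitely many possibilities for \<open>n = z m\<close>.

  Finite presentability. The kernel of an epimorphism from any finitely generated group onto a
  finitely presented group is the normal closure of a finite set
  (\<open>finitely_presented_kernel\<close>). For an extension this is applied to a free group mapping
  onto the quotient, and the usual relators are added: those of the kernel, and those which
  express conjugates of its generators and lifted relators of the quotient as words in these
  generators. For finite index it is applied to the preimage of the subgroup in a free group,
  which is finitely generated by Schreier's argument.
\<close>

section \<open>Discriminating sets and the centre\<close>

lemma (in group_hom) normal_preimage: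
  assumes "N \<lhd> H"
  shows "{x \<in> carrier G. h x \<in> N} \<lhd> G"
proof (rule G.normal_invI)
  interpret N: normal N H by fact
  show "subgroup {x \<in> carrier G. h x \<in> N} G"
    by (rule G.subgroupI) (auto intro: exI[of _ "\<one>"])
  show "x \<otimes> a \<otimes> inv x \<in> {x \<in> carrier G. h x \<in> N}"
    if "x \<in> carrier G" "a \<in> {x \<in> carrier G. h x \<in> N}" for x a
    using that by (auto intro: N.inv_op_closed2)
qed

lemma (in group) mult_inv_eq_one_imp_eq:
  assumes "x \<otimes> inv y = \<one>" "x \<in> carrier G" "y \<in> carrier G"
  shows "x = y"
proof -
  have "x = x \<otimes> inv y \<otimes> y"
    using assms(2,3) by (simp add: m_assoc)
  then show ?thesis
    using assms by simp
qed

lemma finitely_discriminableE: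
  assumes "finitely_discriminable G"
  obtains F where "finite F" "F \<subseteq> carrier G - {\<one>\<^bsub>G\<^esub>}"
    "\<And>N. N \<lhd> G \<Longrightarrow> N \<noteq> {\<one>\<^bsub>G\<^esub>} \<Longrightarrow> N \<inter> F \<noteq> {}"
proof -
  from assms obtain F where F: "finite F \<and> F \<subseteq> carrier G - {\<one>\<^bsub>G\<^esub>} \<and>
      (\<forall>N. N \<lhd> G \<and> N \<noteq> {\<one>\<^bsub>G\<^esub>} \<longrightarrow> N \<inter> F \<noteq> {})"
    unfolding finitely_discriminable_def by (elim conjE exE) (rule that, intro conjI; assumption)
  show thesis
    by (rule that[of F]) (use F in simp_all)
qed

lemma finitely_discriminableI:
  assumes "group G" "finite F" "F \<subseteq> carrier G - {\<one>\<^bsub>G\<^esub>}"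
    and "\<And>N. N \<lhd> G \<Longrightarrow> N \<noteq> {\<one>\<^bsub>G\<^esub>} \<Longrightarrow> N \<inter> F \<noteq> {}"
  shows "finitely_discriminable G"
  unfolding finitely_discriminable_def
  by (intro conjI exI[of _ F] allI impI assms) simp_all

definition center :: "('a, 'b) monoid_scheme \<Rightarrow> 'a set" where
  "center G = {z \<in> carrier G. \<forall>x \<in> carrier G. z \<otimes>\<^bsub>G\<^esub> x = x \<otimes>\<^bsub>G\<^esub> z}"

lemma center_carrier: "z \<in> center G \<Longrightarrow> z \<in> carrier G"
  by (simp add: center_def)

lemma center_commute:
  "z \<in> center G \<Longrightarrow> x \<in> carrier G \<Longrightarrow> z \<otimes>\<^bsub>G\<^esub> x = x \<otimes>\<^bsub>G\<^esub> z"
  by (simp add: center_def)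

lemma (in group) center_nat_pow: "z \<in> center G \<Longrightarrow> z [^] (n::nat) \<in> center G"
  by (auto simp: center_def intro: group_commutes_pow)

lemma (in group) generate_central_normal:
  assumes "z \<in> center G"
  shows "generate G {z} \<lhd> G"
proof (rule normal_generateI)
  show "x \<otimes> h \<otimes> inv x \<in> {z}" if "h \<in> {z}" "x \<in> carrier G" for h x
  proof -
    have "z \<in> carrier G" "x \<otimes> z = z \<otimes> x"
    proof -
      show "z \<in> carrier G"
        using assms by (rule center_carrier)
      show "x \<otimes> z = z \<otimes> x"
        using center_commute[OF assms that(2)] by simp
    qed
    then show ?thesis
      using that by (simp add: m_assoc)
  qed
qed (use assms in \<open>simp add: center_carrier\<close>)

lemma (in group) finitely_discriminable_cyclic_meets:
  assumes "\<And>N. N \<lhd> G \<Longrightarrow> N \<noteq> {\<one>} \<Longrightarrow> N \<inter> F \<noteq> {}" "z \<in> center G" "z \<noteq> \<one>"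
  obtains j :: int where "z [^] j \<in> F"
proof -
  have "z \<in> carrier G"
    using assms(2) by (rule center_carrier)
  have "z \<in> generate G {z}"
    by (simp add: generate.incl)
  then have "generate G {z} \<inter> F \<noteq> {}"
    using assms generate_central_normal by blast
  then show thesis
    using that generate_pow[OF \<open>z \<in> carrier G\<close>] by auto
qed

text \<open>
  If \<open>z\<close> had infinite order, the finite discriminating set would contain only powers of \<open>z\<close>
  with exponent below some \<open>n\<close> in absolute value, so the normal subgroup generated by
  \<open>z\<^sup>n\<close> would avoid it.
\<close>

lemma (in group) finitely_discriminable_center_torsion:
  assumes "finitely_discriminable G" "z \<in> center G"
  obtains k :: nat where "k > 0" "z [^] k = \<one>"
proof (rule ccontr)
  assume "\<not> thesis"
  with that have no: "z [^] k \<noteq> \<one>" if "k > 0" for k :: nat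
    using \<open>0 < k\<close> by blast
  have z: "z \<in> carrier G"
    using assms(2) by (rule center_carrier)
  obtain F where F: "finite F" "F \<subseteq> carrier G - {\<one>}"
      "\<And>N. N \<lhd> G \<Longrightarrow> N \<noteq> {\<one>} \<Longrightarrow> N \<inter> F \<noteq> {}"
    by (rule finitely_discriminableE[OF assms(1)]) (rule that)
  have "z [^] j \<noteq> \<one>" if "j \<noteq> 0" for j :: int
  proof (cases "j > 0")
    case True
    then show ?thesis
      using no[of "nat j"] by (simp add: pow_nat)
  next
    case False
    then have "z [^] (- j) \<noteq> \<one>"
      using no[of "nat (- j)"] that by (simp add: pow_nat)
    then show ?thesis
      using z by (auto simp: int_pow_neg)
  qed
  then have "inj (\<lambda>j::int. z [^] j)"
    using z by (intro injI) (metis int_pow_diff right_minus_eq int_pow_closed r_inv)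
  then have "finite ((\<lambda>j::int. z [^] j) -` F)"
    by (rule finite_vimageI[OF F(1)])
  then obtain n where n: "\<And>j. z [^] j \<in> F \<Longrightarrow> nat \<bar>j\<bar> < n"
    using finite_nat_set_iff_bounded[of "(\<lambda>j. nat \<bar>j\<bar>) ` ((\<lambda>j::int. z [^] j) -` F)"] by auto
  show False
  proof (cases "n = 0")
    case True
    then show False
      using n no[of 1] finitely_discriminable_cyclic_meets[OF F(3) assms(2)] z by auto
  next
    case False
    then obtain j :: int where j: "(z [^] n) [^] j \<in> F"
      using no[of n] finitely_discriminable_cyclic_meets[OF F(3) center_nat_pow[OF assms(2), of n]]
      by auto
    then have "z [^] (int n * j) \<in> F"
      using z by (simp add: int_pow_pow flip: int_pow_int)
    then have "\<bar>int n * j\<bar> < int n"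
      using n[of "int n * j"] by linarith
    then have "j = 0"
      using False by (auto simp: abs_mult)
    then show False
      using j F(2) by auto
  qed
qed

lemma (in group) int_pow_mod_exponent:
  assumes "z \<in> carrier G" "z [^] q = \<one>" "q > (0::nat)"
  shows "z [^] (nat (u mod int q)) = z [^] u"
proof -
  have q: "z [^] int q = \<one>"
    using assms by (simp add: int_pow_int)
  have "z [^] u = z [^] (int q * (u div int q) + u mod int q)"
    by simp
  also have "\<dots> = (z [^] int q) [^] (u div int q) \<otimes> z [^] (u mod int q)"
    using assms by (simp only: int_pow_mult int_pow_pow)
  also have "\<dots> = z [^] (u mod int q)"
    using assms q by simp
  finally show ?thesis
    using assms by (simp add: pow_nat)
qed

text \<open>
  A subgroup of prime order is generated by each of its non-trivial elements. Hence a central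
  element of prime order lies in the cyclic group generated by one of the finitely many
  discriminating elements.
\<close>

lemma (in group) finite_center_pow_prime_eq_one:
  assumes "finitely_discriminable G" "prime q"
  shows "finite {z \<in> center G. z [^] (q::nat) = \<one>}" (is "finite ?T")
proof -
  obtain F where F: "finite F" "F \<subseteq> carrier G - {\<one>}"
      "\<And>N. N \<lhd> G \<Longrightarrow> N \<noteq> {\<one>} \<Longrightarrow> N \<inter> F \<noteq> {}"
    by (rule finitely_discriminableE[OF assms(1)]) (rule that)
  have "q > 0"
    using assms(2) by (rule prime_gt_0_nat)
  have "?T \<subseteq> insert \<one> ((\<lambda>(f, u). f [^] u) ` (F \<times> {..<q}))"
  proof
    fix z assume z: "z \<in> ?T"
    show "z \<in> insert \<one> ((\<lambda>(f, u). f [^] u) ` (F \<times> {..<q}))"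
    proof (cases "z = \<one>")
      case False
      have zc: "z \<in> carrier G" "z \<in> center G" "z [^] int q = \<one>"
        using z by (auto simp: int_pow_int center_carrier)
      obtain j :: int where j: "z [^] j \<in> F"
        using finitely_discriminable_cyclic_meets[OF F(3) zc(2) False] by blast
      have *: "z [^] (int q * c) = \<one>" for c
        using zc int_pow_pow[of z "int q" c] by simp
      have "\<not> int q dvd j"
      proof
        assume "int q dvd j"
        then obtain c where "j = int q * c" ..
        then show False
          using j F(2) * by auto
      qed
      then have "coprime j (int q)"
        using prime_imp_coprime[of "int q" j] assms(2) by (simp add: coprime_commute)
      \<comment> \<open>With \<open>u\<close> inverse to \<open>j\<close> modulo \<open>q\<close>, the discriminating element \<open>z\<^sup>j\<close> has \<open>u\<close>-th power \<open>z\<close>.\<close>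
      then obtain u v where "u * j + v * int q = 1"
        using bezout_int[of j "int q"] by (metis coprime_iff_gcd_eq_1)
      then have "j * u = 1 + int q * (- v)"
        by (simp add: algebra_simps)
      then have u: "(z [^] j) [^] u = z"
        using zc * [of "- v"] by (simp only: int_pow_pow int_pow_mult int_pow_1 r_one)
      have "(z [^] j) [^] q = (z [^] j) [^] int q"
        by (simp add: int_pow_int)
      also have "\<dots> = z [^] (int q * j)"
        using zc by (simp add: int_pow_pow mult.commute)
      finally have "(z [^] j) [^] q = \<one>"
        using * by simp
      then have "(z [^] j) [^] (nat (u mod int q)) = z"
        using int_pow_mod_exponent[of "z [^] j" q u] zc u \<open>q > 0\<close> by simp
      moreover have "nat (u mod int q) < q"
        using \<open>q > 0\<close> by (simp add: nat_less_iff)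
      ultimately show ?thesis
        using j by force
    qed simp
  qed
  then show ?thesis
    using F(1) by (meson finite_SigmaI finite_imageI finite_insert finite_lessThan finite_subset)
qed

lemma (in group) center_subgroup: "subgroup (center G) G"
proof (rule subgroupI)
  show "center G \<subseteq> carrier G"
    by (simp add: center_def)
  have "\<one> \<in> center G"
    by (simp add: center_def)
  then show "center G \<noteq> {}"
    by blast
  show "inv a \<in> center G" if a: "a \<in> center G" for a
    unfolding center_def
  proof safe
    fix x assume x: "x \<in> carrier G"
    have ac: "a \<in> carrier G"
      using a by (rule center_carrier)
    have "a \<otimes> inv x = inv x \<otimes> a"
      using a x by (blast intro: center_commute)
    then have "inv (a \<otimes> inv x) = inv (inv x \<otimes> a)"
      by simp
    then show "inv a \<otimes> x = x \<otimes> inv a"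
      using ac x by (simp add: inv_mult_group)
  qed (use a in \<open>simp add: center_carrier\<close>)
  show "a \<otimes> b \<in> center G" if "a \<in> center G" "b \<in> center G" for a b
    unfolding center_def
  proof safe
    fix x assume x: "x \<in> carrier G"
    have c: "a \<in> carrier G" "b \<in> carrier G" and com: "a \<otimes> x = x \<otimes> a" "b \<otimes> x = x \<otimes> b"
      using that x by (blast intro: center_carrier center_commute)+
    have "a \<otimes> b \<otimes> x = a \<otimes> x \<otimes> b"
      using c x by (simp only: m_assoc com(2))
    also have "\<dots> = x \<otimes> a \<otimes> b"
      by (simp only: com(1))
    also have "\<dots> = x \<otimes> (a \<otimes> b)"
      using c x by (simp add: m_assoc)
    finally show "a \<otimes> b \<otimes> x = x \<otimes> (a \<otimes> b)" .
  next
    show "a \<otimes> b \<in> carrier G"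
      using that by (simp add: center_carrier)
  qed
qed

text \<open>
  Peel off one prime factor \<open>q\<close> of \<open>k = q m\<close>: the \<open>q\<close>-th power maps elements of exponent \<open>k\<close>
  to elements of exponent \<open>m\<close>, and its fibres are cosets of the elements of exponent \<open>q\<close>.
\<close>

lemma (in group) finite_center_pow_eq_one:
  assumes "finitely_discriminable G" "k > 0"
  shows "finite {z \<in> center G. z [^] (k::nat) = \<one>}"
  using assms(2)
proof (induction k rule: less_induct)
  case (less k)
  let ?T = "\<lambda>k::nat. {z \<in> center G. z [^] k = \<one>}"
  interpret Z: subgroup "center G" G
    by (rule center_subgroup)
  show ?case
  proof (cases "k = 1")
    case True
    then have "?T k \<subseteq> {\<one>}"
      by auto
    then show ?thesis
      by (rule finite_subset) simp
  next
    case False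
    then obtain q where q: "prime q" "q dvd k"
      using prime_factor_nat by blast
    then obtain m where m: "k = q * m"
      by auto
    have "m < k" "m > 0"
      using m less.prems prime_gt_1_nat[OF q(1)] by auto
    let ?f = "\<lambda>z. z [^] q"
    have fibre: "finite {z \<in> ?T k. ?f z = y}" for y
    proof (cases "{z \<in> ?T k. ?f z = y} = {}")
      case False
      then obtain a where a: "a \<in> center G" "a [^] q = y"
        by auto
      have "{z \<in> ?T k. ?f z = y} \<subseteq> (\<lambda>t. t \<otimes> a) ` ?T q"
      proof
        fix z assume z: "z \<in> {z \<in> ?T k. ?f z = y}"
        have c: "z \<in> carrier G" "a \<in> carrier G" "z \<in> center G"
          using z a by auto
        have com: "z \<otimes> inv a = inv a \<otimes> z"
          using c by (blast intro: center_commute)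
        have "(z \<otimes> inv a) [^] q = z [^] q \<otimes> inv (a [^] q)"
          using c pow_mult_distrib[OF com] by (simp add: nat_pow_inv)
        also have "\<dots> = a [^] q \<otimes> inv (a [^] q)"
          using z a by simp
        also have "\<dots> = \<one>"
          using c by (intro r_inv nat_pow_closed)
        finally have "(z \<otimes> inv a) [^] q = \<one>" .
        moreover have "z \<otimes> inv a \<in> center G"
          using c(3) a(1) by simp
        moreover have "z = z \<otimes> inv a \<otimes> a"
          using c by (simp add: m_assoc)
        ultimately show "z \<in> (\<lambda>t. t \<otimes> a) ` ?T q"
          by blast
      qed
      then show ?thesis
        using finite_center_pow_prime_eq_one[OF assms(1) q(1)] finite_subset by blast
    next
      case True
      then show ?thesis
        by (simp only: finite.emptyI)
    qed
    have "?T k \<subseteq> (\<Union>y \<in> ?T m. {z \<in> ?T k. ?f z = y})"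
      using m by (auto simp: nat_pow_pow center_nat_pow)
    moreover have "finite (\<Union>y \<in> ?T m. {z \<in> ?T k. ?f z = y})"
      using less.IH[OF \<open>m < k\<close> \<open>m > 0\<close>] fibre by blast
    ultimately show ?thesis
      by (rule finite_subset)
  qed
qed

section \<open>Finite discriminability of extensions and finite-index overgroups\<close>

text \<open>
  With \<open>L\<close> the image of \<open>K\<close>, only the normal subgroups that meet \<open>L\<close> trivially need new
  discriminating elements, and each of them projects to a subgroup containing some \<open>f \<in> B\<close>. The
  set \<open>D\<close> for a given \<open>f\<close> comes from one fixed such subgroup \<open>M\<close> with \<open>m \<in> M\<close> over \<open>f\<close>. Given
  another one \<open>N\<close> with \<open>n \<in> N\<close> over \<open>f\<close>, a non-trivial \<open>N \<inter> M\<close> contains one of the finitely many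
  elements of \<open>M\<close> over \<open>B\<close>. Otherwise \<open>N\<close>, \<open>M\<close> commute with each other and with \<open>L\<close>, so
  \<open>z = n m\<^sup>-\<^sup>1\<close> is central in \<open>L\<close> and hence torsion. From \<open>z\<^sup>j = 1\<close> it follows that
  \<open>n\<^sup>j = m\<^sup>j \<in> N \<inter> M = {1}\<close>; so \<open>m\<close> has finite order, and an exponent \<open>k\<close> of \<open>m\<close>
  gives \<open>z\<^sup>k = n\<^sup>k \<in> N \<inter> L = {1}\<close>.
\<close>

lemma finitely_discriminable_extension:
  assumes "short_exact_sequence K i G p Q" "finitely_discriminable K" "finitely_discriminable Q"
  shows "finitely_discriminable G"
proof -
  have ses: "group K" "group G" "group Q" "i \<in> hom K G" "inj_on i (carrier K)"
      "p \<in> hom G Q" "p ` carrier G = carrier Q" "i ` carrier K = kernel G Q p"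
    using assms(1) by (auto simp: short_exact_sequence_def mon_def epi_def)
  interpret K: group K by fact
  interpret G: group G by fact
  interpret Q: group Q by fact
  interpret i: group_hom K G i
    by unfold_locales fact
  interpret p: group_hom G Q p
    by unfold_locales fact
  define L where "L = i ` carrier K"
  have L: "x \<in> L \<longleftrightarrow> x \<in> carrier G \<and> p x = \<one>\<^bsub>Q\<^esub>" for x
    using ses(8) by (simp add: L_def kernel_def)
  have L_normal: "L \<lhd> G"
    using p.normal_kernel ses(8) by (simp add: L_def)
  obtain A where A: "finite A" "A \<subseteq> carrier K - {\<one>\<^bsub>K\<^esub>}"
      "\<And>N. N \<lhd> K \<Longrightarrow> N \<noteq> {\<one>\<^bsub>K\<^esub>} \<Longrightarrow> N \<inter> A \<noteq> {}"
    by (rule finitely_discriminableE[OF assms(2)]) (rule that)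
  obtain B where B: "finite B" "B \<subseteq> carrier Q - {\<one>\<^bsub>Q\<^esub>}"
      "\<And>N. N \<lhd> Q \<Longrightarrow> N \<noteq> {\<one>\<^bsub>Q\<^esub>} \<Longrightarrow> N \<inter> B \<noteq> {}"
    by (rule finitely_discriminableE[OF assms(3)]) (rule that)
  have meets_A: "N \<inter> i ` A \<noteq> {}" if N: "N \<lhd> G" "N \<inter> L \<noteq> {\<one>\<^bsub>G\<^esub>}" for N
  proof -
    interpret N: normal N G by fact
    have "\<one>\<^bsub>G\<^esub> \<in> N \<inter> L"
      by (simp add: L)
    then obtain x where "x \<in> N" "x \<in> L" "x \<noteq> \<one>\<^bsub>G\<^esub>"
      using N(2) by blast
    then obtain y where "y \<in> carrier K" "i y \<in> N" "i y \<noteq> \<one>\<^bsub>G\<^esub>"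
      by (auto simp: L_def)
    then have "y \<in> {x \<in> carrier K. i x \<in> N}" "y \<noteq> \<one>\<^bsub>K\<^esub>"
      by auto
    then have "{x \<in> carrier K. i x \<in> N} \<noteq> {\<one>\<^bsub>K\<^esub>}"
      by blast
    then have "{x \<in> carrier K. i x \<in> N} \<inter> A \<noteq> {}"
      by (intro A(3) i.normal_preimage N(1))
    then show ?thesis
      by auto
  qed
  have p_inj: "x = y" if "N \<lhd> G" "N \<inter> L = {\<one>\<^bsub>G\<^esub>}" "x \<in> N" "y \<in> N" "p x = p y" for N x y
  proof -
    interpret N: normal N G by fact
    have "x \<otimes>\<^bsub>G\<^esub> inv\<^bsub>G\<^esub> y \<in> N \<inter> L"
      using that(3-5) by (simp add: L)
    then have "x \<otimes>\<^bsub>G\<^esub> inv\<^bsub>G\<^esub> y = \<one>\<^bsub>G\<^esub>"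
      using that(2) by simp
    then show ?thesis
      by (rule G.mult_inv_eq_one_imp_eq) (simp_all add: that(3,4))
  qed
  define good where "good f N \<longleftrightarrow> N \<lhd> G \<and> N \<inter> L = {\<one>\<^bsub>G\<^esub>} \<and> f \<in> p ` N" for f N
  have "\<exists>D. finite D \<and> D \<subseteq> carrier G - {\<one>\<^bsub>G\<^esub>} \<and> (\<forall>N. good f N \<longrightarrow> N \<inter> D \<noteq> {})"
    if f: "f \<in> B" for f
  proof (cases "\<exists>N. good f N")
    case False
    then show ?thesis
      by blast
  next
    case True
    then obtain M m where M: "M \<lhd> G" "M \<inter> L = {\<one>\<^bsub>G\<^esub>}" "m \<in> M" "p m = f"
      by (auto simp: good_def)
    interpret M: normal M G by fact
    \<comment> \<open>an exponent of \<open>m\<close> if it has finite order, and an arbitrary number otherwise\<close>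
    obtain k :: nat where k: "k > 0" "\<And>j::nat. j > 0 \<Longrightarrow> m [^]\<^bsub>G\<^esub> j = \<one>\<^bsub>G\<^esub> \<Longrightarrow> m [^]\<^bsub>G\<^esub> k = \<one>\<^bsub>G\<^esub>"
      by (cases "\<exists>j::nat. j > 0 \<and> m [^]\<^bsub>G\<^esub> j = \<one>\<^bsub>G\<^esub>") (blast, meson zero_less_one)
    define T where "T = i ` {z \<in> center K. z [^]\<^bsub>K\<^esub> k = \<one>\<^bsub>K\<^esub>}"
    define D where "D = {x \<in> M. p x \<in> B} \<union> ((\<lambda>z. z \<otimes>\<^bsub>G\<^esub> m) ` T - {\<one>\<^bsub>G\<^esub>})"
    have "finite {x \<in> M. p x \<in> B}"
      by (rule inj_on_finite[of p _ B]) (use p_inj[OF M(1,2)] B(1) in \<open>auto simp: inj_on_def\<close>)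
    moreover have "finite T"
      unfolding T_def by (intro finite_imageI K.finite_center_pow_eq_one assms(2) k(1))
    ultimately have "finite D"
      by (simp add: D_def)
    moreover have "T \<subseteq> carrier G"
      by (auto simp: T_def center_carrier)
    then have "D \<subseteq> carrier G - {\<one>\<^bsub>G\<^esub>}"
      using B(2) M(3) by (auto simp: D_def)
    moreover have "N \<inter> D \<noteq> {}" if gN: "good f N" for N
    proof -
      obtain n where N: "N \<lhd> G" "N \<inter> L = {\<one>\<^bsub>G\<^esub>}" "n \<in> N" "p n = f"
        using gN by (auto simp: good_def)
      interpret N: normal N G by fact
      show ?thesis
      proof (cases "N \<inter> M = {\<one>\<^bsub>G\<^esub>}")
        case False
        interpret NM: normal "N \<inter> M" G
          by (intro G.normal_subgroup_intersect N M)
        have "p ` (N \<inter> M) \<lhd> Q"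
          using NM.surj_hom_normal_subgroup[OF p.group_hom_axioms ses(7)] .
        moreover have "p ` (N \<inter> M) \<noteq> {\<one>\<^bsub>Q\<^esub>}"
        proof
          assume "p ` (N \<inter> M) = {\<one>\<^bsub>Q\<^esub>}"
          then have "N \<inter> M \<subseteq> N \<inter> L"
            by (auto simp: L)
          then show False
            using False N(2) NM.one_closed by blast
        qed
        ultimately obtain x where "x \<in> N" "x \<in> M" "p x \<in> B"
          using B(3)[of "p ` (N \<inter> M)"] by blast
        then show ?thesis
          by (auto simp: D_def)
      next
        case True
        let ?z = "n \<otimes>\<^bsub>G\<^esub> inv\<^bsub>G\<^esub> m"
        have zL: "?z \<in> L"
          using N M f B(2) by (auto simp: L)
        then obtain y where y: "y \<in> carrier K" "i y = ?z"
          unfolding L_def by (metis imageE)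
        have y_center: "y \<in> center K"
          unfolding center_def
        proof safe
          fix x assume x: "x \<in> carrier K"
          then have "i x \<in> L"
            by (simp add: L_def)
          have c: "i x \<in> carrier G" "n \<in> carrier G" "inv\<^bsub>G\<^esub> m \<in> carrier G"
            using x N(3) M(3) by auto
          have n: "i x \<otimes>\<^bsub>G\<^esub> n = n \<otimes>\<^bsub>G\<^esub> i x"
            using G.normal_imp_commuting[OF N(1) L_normal _ N(3) \<open>i x \<in> L\<close>] N(2) by simp
          have m: "i x \<otimes>\<^bsub>G\<^esub> inv\<^bsub>G\<^esub> m = inv\<^bsub>G\<^esub> m \<otimes>\<^bsub>G\<^esub> i x"
            using G.normal_imp_commuting[OF M(1) L_normal _ _ \<open>i x \<in> L\<close>] M(2,3) by simp
          have "i x \<otimes>\<^bsub>G\<^esub> ?z = i x \<otimes>\<^bsub>G\<^esub> n \<otimes>\<^bsub>G\<^esub> inv\<^bsub>G\<^esub> m"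
            using c by (simp only: G.m_assoc)
          also have "\<dots> = n \<otimes>\<^bsub>G\<^esub> (i x \<otimes>\<^bsub>G\<^esub> inv\<^bsub>G\<^esub> m)"
            using c by (simp only: n G.m_assoc)
          also have "\<dots> = ?z \<otimes>\<^bsub>G\<^esub> i x"
            using c by (simp only: m G.m_assoc)
          finally have "i x \<otimes>\<^bsub>G\<^esub> ?z = ?z \<otimes>\<^bsub>G\<^esub> i x" .
          then have "i (y \<otimes>\<^bsub>K\<^esub> x) = i (x \<otimes>\<^bsub>K\<^esub> y)"
            using x y by simp
          then show "y \<otimes>\<^bsub>K\<^esub> x = x \<otimes>\<^bsub>K\<^esub> y"
            by (rule inj_onD[OF ses(5)]) (simp_all add: x y(1))
        qed (use y in auto)
        have commute: "m \<otimes>\<^bsub>G\<^esub> n = n \<otimes>\<^bsub>G\<^esub> m" "inv\<^bsub>G\<^esub> m \<otimes>\<^bsub>G\<^esub> n = n \<otimes>\<^bsub>G\<^esub> inv\<^bsub>G\<^esub> m"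
          using G.normal_imp_commuting[OF N(1) M(1) _ N(3)] True M(3) by auto
        have pow: "?z [^]\<^bsub>G\<^esub> j = n [^]\<^bsub>G\<^esub> j \<otimes>\<^bsub>G\<^esub> inv\<^bsub>G\<^esub> (m [^]\<^bsub>G\<^esub> j)" for j :: nat
          using commute(2) N(3) M(3) by (simp add: G.pow_mult_distrib G.nat_pow_inv)
        have pows: "n [^]\<^bsub>G\<^esub> j \<in> N" "m [^]\<^bsub>G\<^esub> j \<in> M" for j :: nat
          using N(3) M(3) by (induction j) auto
        obtain j :: nat where j: "j > 0" "y [^]\<^bsub>K\<^esub> j = \<one>\<^bsub>K\<^esub>"
          using K.finitely_discriminable_center_torsion[OF assms(2) y_center] by blast
        have "?z [^]\<^bsub>G\<^esub> j = \<one>\<^bsub>G\<^esub>"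
          using j(2) y i.hom_nat_pow[of y j] by simp
        then have "n [^]\<^bsub>G\<^esub> j = m [^]\<^bsub>G\<^esub> j"
          unfolding pow by (rule G.mult_inv_eq_one_imp_eq) (simp_all add: N(3) M(3))
        then have "m [^]\<^bsub>G\<^esub> j \<in> N \<inter> M"
          using pows by (metis IntI)
        then have "m [^]\<^bsub>G\<^esub> j = \<one>\<^bsub>G\<^esub>"
          using True by simp
        then have "m [^]\<^bsub>G\<^esub> k = \<one>\<^bsub>G\<^esub>"
          using k(2) j(1) by blast
        then have "?z [^]\<^bsub>G\<^esub> k \<in> N"
          using pow[of k] pows(1)[of k] N(3) by simp
        moreover have zk: "?z [^]\<^bsub>G\<^esub> k = i (y [^]\<^bsub>K\<^esub> k)"
          using y i.hom_nat_pow[of y k] by simp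
        ultimately have "i (y [^]\<^bsub>K\<^esub> k) \<in> N \<inter> L"
          using y(1) by (simp add: L_def)
        then have "i (y [^]\<^bsub>K\<^esub> k) = i \<one>\<^bsub>K\<^esub>"
          using N(2) by simp
        then have "y [^]\<^bsub>K\<^esub> k = \<one>\<^bsub>K\<^esub>"
          by (rule inj_onD[OF ses(5)]) (simp_all add: y(1))
        then have zT: "?z \<in> T"
          using y y_center by (force simp: T_def)
        have zm: "n = ?z \<otimes>\<^bsub>G\<^esub> m"
          using N(3) M(3) by (simp add: G.m_assoc)
        have "n \<noteq> \<one>\<^bsub>G\<^esub>"
          using N(4) f B(2) by auto
        moreover have "n \<in> (\<lambda>z. z \<otimes>\<^bsub>G\<^esub> m) ` T"
          by (rule image_eqI[of _ _ ?z]) (rule zm, rule zT)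
        ultimately have "n \<in> D"
          unfolding D_def by blast
        then show ?thesis
          using N(3) by blast
      qed
    qed
    ultimately show ?thesis
      by blast
  qed
  then obtain D where D: "\<And>f. f \<in> B \<Longrightarrow> finite (D f)"
      "\<And>f. f \<in> B \<Longrightarrow> D f \<subseteq> carrier G - {\<one>\<^bsub>G\<^esub>}"
      "\<And>f N. f \<in> B \<Longrightarrow> good f N \<Longrightarrow> N \<inter> D f \<noteq> {}"
    by metis
  have meets: "N \<inter> (i ` A \<union> (\<Union>f\<in>B. D f)) \<noteq> {}" if N: "N \<lhd> G" "N \<noteq> {\<one>\<^bsub>G\<^esub>}" for N
  proof (cases "N \<inter> L = {\<one>\<^bsub>G\<^esub>}")
    case True
    interpret N: normal N G by fact
    have "p ` N \<noteq> {\<one>\<^bsub>Q\<^esub>}"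
    proof
      assume "p ` N = {\<one>\<^bsub>Q\<^esub>}"
      then have "N \<subseteq> N \<inter> L"
        by (auto simp: L)
      then show False
        using True N(2) N.one_closed by auto
    qed
    moreover have "p ` N \<lhd> Q"
      using N.surj_hom_normal_subgroup[OF p.group_hom_axioms ses(7)] .
    ultimately obtain f where "f \<in> B" "f \<in> p ` N"
      using B(3) by blast
    then show ?thesis
      using D(3)[of f N] N(1) True by (auto simp: good_def)
  next
    case False
    then show ?thesis
      using meets_A N(1) by blast
  qed
  have fin: "finite (i ` A \<union> (\<Union>f\<in>B. D f))"
    using A(1) B(1) D(1) by blast
  have "i ` A \<subseteq> carrier G - {\<one>\<^bsub>G\<^esub>}"
  proof -
    have "i a \<noteq> i \<one>\<^bsub>K\<^esub>" if "a \<in> A" for a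
      using A(2) that ses(5) by (metis DiffE K.one_closed inj_onD insertI1 subsetD)
    then show ?thesis
      using A(2) by auto
  qed
  then have sub: "i ` A \<union> (\<Union>f\<in>B. D f) \<subseteq> carrier G - {\<one>\<^bsub>G\<^esub>}"
    using D(2) by blast
  show ?thesis
    by (rule finitely_discriminableI[OF G.is_group fin sub meets])
qed

text \<open>
  A non-trivial normal subgroup \<open>N\<close> with \<open>N \<inter> H = {1}\<close> meets some coset \<open>c \<noteq> H\<close>. If \<open>M\<close> is a fixed
  normal subgroup of this kind meeting \<open>c\<close> in \<open>m\<close>, then \<open>M\<close> is finite because it injects into the
  cosets. If \<open>NM \<inter> H\<close> is trivial, then elements of \<open>N\<close> and \<open>M\<close> in the same coset coincide, so
  \<open>m \<in> N\<close>; otherwise \<open>NM\<close> contains an \<open>a\<close> from the discriminating set of \<open>H\<close>, and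
  \<open>N\<close> meets the finite set \<open>a M\<close> non-trivially.
\<close>

lemma (in group) finitely_discriminable_overgroup:
  assumes H: "subgroup H G" "finite (rcosets H)"
    and fd: "finitely_discriminable (G\<lparr>carrier := H\<rparr>)"
  shows "finitely_discriminable G"
proof -
  interpret H: subgroup H G by fact
  obtain A where A: "finite A" "A \<subseteq> H - {\<one>}"
      "\<And>N. N \<lhd> G\<lparr>carrier := H\<rparr> \<Longrightarrow> N \<noteq> {\<one>} \<Longrightarrow> N \<inter> A \<noteq> {}"
    by (rule finitely_discriminableE[OF fd]) (rule that, simp_all)
  have meets_A: "N \<inter> A \<noteq> {}" if "N \<lhd> G" "N \<inter> H \<noteq> {\<one>}" for N
  proof -
    have "N \<inter> H \<lhd> G\<lparr>carrier := H\<rparr>"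
      using normal_Int_subgroup[OF H(1) that(1)] by (simp add: Int_commute)
    then show ?thesis
      using A(3) that(2) by blast
  qed
  define good where "good c N \<longleftrightarrow> N \<lhd> G \<and> N \<inter> H = {\<one>} \<and> N \<inter> c \<noteq> {}" for c N
  have "\<exists>D. finite D \<and> D \<subseteq> carrier G - {\<one>} \<and> (\<forall>N. good c N \<longrightarrow> N \<inter> D \<noteq> {})"
    if c: "c \<in> rcosets H - {H}" for c
  proof (cases "\<exists>N. good c N")
    case False
    then show ?thesis
      by blast
  next
    case True
    then obtain M m where M: "M \<lhd> G" "M \<inter> H = {\<one>}" "m \<in> M" "m \<in> c"
      by (auto simp: good_def)
    interpret M: normal M G by fact
    have "disjnt c H"
      using pairwiseD[OF rcos_disjoint[OF H(1)], of c H] c H.subgroup_in_rcosets[OF is_group]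
      by simp
    then have not_one: "x \<noteq> \<one>" if "x \<in> c" for x
      using that H.one_closed by (auto simp: disjnt_iff)
    have fin_M: "finite M"
    proof (rule inj_on_finite[of "\<lambda>x. H #> x" _ "rcosets H"])
      show "inj_on (\<lambda>x. H #> x) M"
      proof (rule inj_onI)
        fix x y assume xy: "x \<in> M" "y \<in> M" "H #> x = H #> y"
        then have "x \<in> H #> y"
          using rcos_self[OF _ H(1), of x] by simp
        then have "x \<otimes> inv y \<in> M \<inter> H"
          using xy(1,2) H.rcos_module_imp[OF is_group, of y x] by simp
        then have "x \<otimes> inv y = \<one>"
          using M(2) by simp
        then show "x = y"
          by (rule mult_inv_eq_one_imp_eq) (simp_all add: xy(1,2))
      qed
    qed (auto intro: rcosetsI H.subset H(2))
    let ?D = "insert m ((\<lambda>(a, x). a \<otimes> x) ` (A \<times> M)) - {\<one>}"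
    have D1: "finite ?D"
      using A(1) fin_M by simp
    have D2: "?D \<subseteq> carrier G - {\<one>}"
      using A(2) M(3) by auto
    have D3: "N \<inter> ?D \<noteq> {}" if gN: "good c N" for N
    proof -
      obtain n where N: "N \<lhd> G" "N \<inter> H = {\<one>}" "n \<in> N" "n \<in> c"
        using gN by (auto simp: good_def)
      interpret N: normal N G by fact
      show ?thesis
      proof (cases "(N <#> M) \<inter> H = {\<one>}")
        case True
        obtain x where x: "x \<in> carrier G" "c = H #> x"
          using c by (auto simp: RCOSETS_def)
        have "H #> m = c"
          using x M(4) repr_independence[OF _ _ H(1)] by blast
        then have "n \<in> H #> m"
          using N(4) by simp
        then have "n \<otimes> inv m \<in> H"
          using M(3) N(3) H.rcos_module_imp[OF is_group] by simp
        moreover have "n \<otimes> inv m \<in> N <#> M"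
          using N(3) M(3) by (auto simp: set_mult_def)
        ultimately have "n \<otimes> inv m \<in> (N <#> M) \<inter> H"
          by (rule IntI[rotated])
        then have "n \<otimes> inv m = \<one>"
          using True by simp
        then have "n = m"
          by (rule mult_inv_eq_one_imp_eq) (simp_all add: N(3) M(3))
        then show ?thesis
          using N(3) not_one[OF N(4)] by auto
      next
        case False
        have "N <#> M \<lhd> G"
          by (rule normal_subgroup_set_mult_closed[OF N(1) M(1)])
        then obtain a where "a \<in> N <#> M" "a \<in> A"
          using meets_A False by blast
        then obtain x y where xy: "x \<in> N" "y \<in> M" "a = x \<otimes> y"
          by (auto simp: set_mult_def)
        have "x \<noteq> \<one>"
        proof
          assume "x = \<one>"
          then have "a \<in> M \<inter> H"
            using xy \<open>a \<in> A\<close> A(2) by auto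
          then show False
            using M(2) \<open>a \<in> A\<close> A(2) by auto
        qed
        moreover have "x = a \<otimes> inv y"
          using xy by (simp add: m_assoc)
        then have "x \<in> (\<lambda>(a, x). a \<otimes> x) ` (A \<times> M)"
          using \<open>a \<in> A\<close> xy(2) by force
        ultimately show ?thesis
          using xy(1) by blast
      qed
    qed
    show ?thesis
      by (intro exI[of _ ?D] conjI allI impI D1 D2 D3)
  qed
  then obtain D where D: "\<And>c. c \<in> rcosets H - {H} \<Longrightarrow> finite (D c)"
      "\<And>c. c \<in> rcosets H - {H} \<Longrightarrow> D c \<subseteq> carrier G - {\<one>}"
      "\<And>c N. c \<in> rcosets H - {H} \<Longrightarrow> good c N \<Longrightarrow> N \<inter> D c \<noteq> {}"
    by metis
  have meets: "N \<inter> (A \<union> (\<Union>c \<in> rcosets H - {H}. D c)) \<noteq> {}" if N: "N \<lhd> G" "N \<noteq> {\<one>}" for N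
  proof (cases "N \<inter> H = {\<one>}")
    case True
    interpret N: normal N G by fact
    obtain n where n: "n \<in> N" "n \<noteq> \<one>"
      using N(2) N.one_closed by blast
    have "n \<notin> H"
    proof
      assume "n \<in> H"
      then have "n \<in> N \<inter> H"
        using n(1) by blast
      then show False
        using True n(2) by simp
    qed
    moreover have "n \<in> H #> n" "H #> n \<in> rcosets H"
      using n(1) rcos_self[OF _ H(1)] rcosetsI[OF H.subset] by auto
    ultimately have "H #> n \<in> rcosets H - {H}" "good (H #> n) N"
      using n(1) N(1) True by (auto simp: good_def)
    then show ?thesis
      using D(3) by blast
  next
    case False
    then show ?thesis
      using meets_A N(1) by blast
  qed
  have fin: "finite (A \<union> (\<Union>c \<in> rcosets H - {H}. D c))"
    using A(1) H(2) D(1) by blast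
  have sub: "A \<union> (\<Union>c \<in> rcosets H - {H}. D c) \<subseteq> carrier G - {\<one>}"
    using A(2) H.subset D(2) by blast
  show ?thesis
    by (rule finitely_discriminableI[OF is_group fin sub meets])
qed

section \<open>Kernels onto finitely presented groups\<close>

text \<open>
  For a normal subgroup \<open>N\<close> this says that \<open>N\<close> is the normal closure of a finite set; the
  universal property is the form in which normal closures are used throughout.
\<close>

definition finitely_normally_generated :: "('a, 'b) monoid_scheme \<Rightarrow> 'a set \<Rightarrow> bool" where
  "finitely_normally_generated G N \<longleftrightarrow>
     (\<exists>A. finite A \<and> A \<subseteq> N \<and> (\<forall>M. M \<lhd> G \<and> A \<subseteq> M \<longrightarrow> N \<subseteq> M))"

definition finitely_presented :: "('a, 'b) monoid_scheme \<Rightarrow> bool" where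
  "finitely_presented G \<longleftrightarrow> group G \<and>
     (\<exists>m. \<exists>\<pi> \<in> epi (free_group m) G.
        finitely_normally_generated (free_group m) (kernel (free_group m) G \<pi>))"

lemma finitely_normally_generatedE:
  assumes "finitely_normally_generated G N"
  obtains A where "finite A" "A \<subseteq> N" "\<And>M. M \<lhd> G \<Longrightarrow> A \<subseteq> M \<Longrightarrow> N \<subseteq> M"
proof -
  from assms obtain A where A: "finite A" "A \<subseteq> N" "\<forall>M. M \<lhd> G \<and> A \<subseteq> M \<longrightarrow> N \<subseteq> M"
    unfolding finitely_normally_generated_def by (elim exE conjE) (rule that)
  show thesis
    by (rule that[of A]) (use A in simp_all)
qed

lemma finitely_generated_groupE:
  assumes "finitely_generated_group G"
  obtains S where "finite S" "S \<subseteq> carrier G" "generate G S = carrier G"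
  using assms unfolding finitely_generated_group_def by (elim exE conjE) (rule that)

lemma finitely_generated_groupI:
  assumes "group G" "finite S" "S \<subseteq> carrier G" "carrier G \<subseteq> generate G S"
  shows "finitely_generated_group G"
  using assms group.generate_incl[OF assms(1,3)]
  unfolding finitely_generated_group_def by blast

definition free_generators :: "nat \<Rightarrow> letter list set" where
  "free_generators m = (\<lambda>k. [(k, True)]) ` {..<m}"

lemma free_generators_subset: "free_generators m \<subseteq> carrier (free_group m)"
  by (auto simp: free_generators_def free_group_def reduced_Cons)

lemma generate_free_generators:
  "generate (free_group m) (free_generators m) = carrier (free_group m)"
proof
  interpret group "free_group m"
    by (rule group_free_group)
  show "generate (free_group m) (free_generators m) \<subseteq> carrier (free_group m)"
    by (rule generate_incl[OF free_generators_subset])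
  have letter: "[(k, b)] \<in> generate (free_group m) (free_generators m)" if "k < m" for k b
  proof (cases b)
    case True
    then show ?thesis
      using that by (auto simp: free_generators_def intro: generate.incl)
  next
    case False
    have "[(k, True)] \<in> free_generators m" "[(k, False)] \<in> carrier (free_group m)"
      using that by (auto simp: free_generators_def free_group_def reduced_Cons)
    moreover from this have "inv\<^bsub>free_group m\<^esub> [(k, True)] = [(k, False)]"
      using free_generators_subset
      by (intro inv_equality) (auto simp: free_group_def flip_def)
    ultimately show ?thesis
      using False by (metis (full_types) generate.inv)
  qed
  show "carrier (free_group m) \<subseteq> generate (free_group m) (free_generators m)"
  proof
    fix w assume "w \<in> carrier (free_group m)"
    then have "w \<in> lists ({..<m} \<times> UNIV)" "reduced w"
      by (auto simp: free_group_def)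
    then show "w \<in> generate (free_group m) (free_generators m)"
    proof (induction w)
      case Nil
      then show ?case
        using generate.one[of "free_group m"] by (simp add: free_group_def)
    next
      case (Cons x w)
      have "[x] \<otimes>\<^bsub>free_group m\<^esub> w = x # w"
        using Cons.prems by (simp add: free_group_def push_reduced)
      moreover have "[x] \<in> generate (free_group m) (free_generators m)"
        using Cons.hyps letter by (cases x) auto
      moreover have "w \<in> generate (free_group m) (free_generators m)"
        using Cons.IH Cons.prems by (simp add: reduced_Cons)
      ultimately show ?case
        by (metis generate.eng)
    qed
  qed
qed

lemma finitely_generated_free_group: "finitely_generated_group (free_group m)"
  by (rule finitely_generated_groupI[OF group_free_group _ free_generators_subset])
     (simp_all add: generate_free_generators, simp add: free_generators_def)

lemma (in group) hom_eq_on_generate: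
  assumes "group H" "f \<in> hom G H" "g \<in> hom G H" "S \<subseteq> carrier G" "\<And>x. x \<in> S \<Longrightarrow> f x = g x"
    and "x \<in> generate G S"
  shows "f x = g x"
proof -
  interpret f: group_hom G H f
    by (intro group_hom.intro group_hom_axioms.intro is_group assms)
  interpret g: group_hom G H g
    by (intro group_hom.intro group_hom_axioms.intro is_group assms)
  have "x \<in> carrier G \<and> f x = g x"
    using assms(6)
  proof induction
    case (incl h)
    then show ?case
      using assms(4,5) by auto
  next
    case (inv h)
    then have "h \<in> carrier G" "f h = g h"
      using assms(4,5) by auto
    then show ?case
      by simp
  qed auto
  then show ?thesis ..
qed

text \<open>
  Projectivity of free groups: a homomorphism out of a free group can be prescribed on the
  generators, and it is determined there.
\<close>

lemma free_group_lift:
  assumes E: "group E" and H: "group H" and q: "q \<in> epi E H" and \<pi>: "\<pi> \<in> hom (free_group m) H"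
  obtains j where "j \<in> hom (free_group m) E" "\<And>w. w \<in> carrier (free_group m) \<Longrightarrow> q (j w) = \<pi> w"
proof -
  have qh: "q \<in> hom E H" and surj: "q ` carrier E = carrier H"
    using q by (auto simp: epi_def)
  have "\<exists>e \<in> carrier E. q e = \<pi> [(k, True)]" if "k < m" for k
  proof -
    have "[(k, True)] \<in> carrier (free_group m)"
      using that free_generators_subset by (auto simp: free_generators_def)
    then have "\<pi> [(k, True)] \<in> q ` carrier E"
      using hom_in_carrier[OF \<pi>] surj by simp
    then show ?thesis
      by (metis imageE)
  qed
  then obtain f where f: "\<And>k. k < m \<Longrightarrow> f k \<in> carrier E" "\<And>k. k < m \<Longrightarrow> q (f k) = \<pi> [(k, True)]"
    by metis
  obtain j where j: "j \<in> hom (free_group m) E" "\<And>k. k < m \<Longrightarrow> j [(k, True)] = f k"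
    using group.free_group_hom_extension[OF E, of m f] f(1) by blast
  have "(q \<circ> j) w = \<pi> w" if w: "w \<in> carrier (free_group m)" for w
  proof (rule group.hom_eq_on_generate[OF group_free_group H _ \<pi> free_generators_subset])
    show "q \<circ> j \<in> hom (free_group m) H"
      by (rule Group.hom_compose[OF j(1) qh])
    show "(q \<circ> j) x = \<pi> x" if "x \<in> free_generators m" for x
      using that f(2) j(2) by (auto simp: free_generators_def)
  qed (simp add: generate_free_generators w)
  then show thesis
    using that j(1) by simp
qed

lemma epi_image_generate:
  assumes "group E" "group H" "q \<in> epi E H" "S \<subseteq> carrier E" "generate E S = carrier E"
  shows "generate H (q ` S) = carrier H"
proof -
  interpret group_hom E H q
    using assms by (simp add: group_hom_def group_hom_axioms_def epi_def)
  show ?thesis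
    using assms generate_img[OF assms(4)] by (simp add: epi_def)
qed

lemma finitely_generated_epi_image:
  assumes "finitely_generated_group E" "group H" "q \<in> epi E H"
  shows "finitely_generated_group H"
proof -
  have E: "group E"
    using assms(1) by (simp add: finitely_generated_group_def)
  obtain S where S: "finite S" "S \<subseteq> carrier E" "generate E S = carrier E"
    by (rule finitely_generated_groupE[OF assms(1)]) (rule that)
  show ?thesis
  proof (rule finitely_generated_groupI[OF assms(2)])
    show "finite (q ` S)"
      using S(1) by simp
    show "q ` S \<subseteq> carrier H"
      using S(2) assms(3) by (auto simp: epi_def)
    show "carrier H \<subseteq> generate H (q ` S)"
      using epi_image_generate[OF E assms(2,3) S(2,3)] by simp
  qed
qed

lemma finitely_presented_imp_finitely_generated:
  assumes "finitely_presented G"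
  shows "finitely_generated_group G"
  using assms finitely_generated_epi_image[OF finitely_generated_free_group]
  unfolding finitely_presented_def by blast

lemma finitely_generated_quotient_of_free_group:
  assumes "finitely_generated_group G"
  obtains m \<pi> where "\<pi> \<in> epi (free_group m) G"
proof -
  interpret G: group G
    using assms by (simp add: finitely_generated_group_def)
  obtain S where S: "finite S" "S \<subseteq> carrier G" "generate G S = carrier G"
    by (rule finitely_generated_groupE[OF assms]) (rule that)
  obtain m f where f: "S = f ` {i::nat. i < m}"
    using finite_imp_nat_seg_image_inj_on[OF S(1)] by blast
  obtain h where h: "h \<in> hom (free_group m) G" "\<And>k. k < m \<Longrightarrow> h [(k, True)] = f k"
    using G.free_group_hom_extension[of m f] f S(2) by blast
  interpret h: group_hom "free_group m" G h
    by (intro group_hom.intro group_hom_axioms.intro group_free_group G.is_group h(1))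
  have "h ` free_generators m = S"
    unfolding free_generators_def image_image f by (rule image_cong) (auto simp: h(2))
  then have "h ` carrier (free_group m) = carrier G"
    using h.generate_img[OF free_generators_subset] S(3) by (simp add: generate_free_generators)
  then have "h \<in> epi (free_group m) G"
    using h(1) by (simp add: epi_def)
  then show thesis
    by (rule that)
qed

text \<open>
  The scheme common to both finite presentability arguments. Here \<open>F\<close> is a free group with
  relators \<open>A\<close> and \<open>j\<close> realises its generators in \<open>E\<close>. Once enough relations, collected in \<open>M\<close>, allow
  every element of the kernel to be rewritten modulo \<open>M\<close> as a word in these generators, that
  word is a consequence of \<open>A\<close>, and \<open>M\<close> is the whole kernel.
\<close>

lemma kernel_subset_of_cover:
  assumes j: "group_hom F E j" and q: "group_hom E H q"
    and A: "\<And>M. M \<lhd> F \<Longrightarrow> A \<subseteq> M \<Longrightarrow> kernel F H (q \<circ> j) \<subseteq> M" "A \<subseteq> carrier F"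
    and M: "M \<lhd> E" "M \<subseteq> kernel E H q" "j ` A \<subseteq> M"
    and cover: "kernel E H q \<subseteq> M <#>\<^bsub>E\<^esub> j ` carrier F"
  shows "kernel E H q \<subseteq> M"
proof
  interpret j: group_hom F E j by fact
  interpret q: group_hom E H q by fact
  interpret M: normal M E by fact
  fix x assume x: "x \<in> kernel E H q"
  obtain a w where aw: "a \<in> M" "w \<in> carrier F" "x = a \<otimes>\<^bsub>E\<^esub> j w"
    using x cover by (auto simp: set_mult_def)
  have "q a = \<one>\<^bsub>H\<^esub>" "q x = \<one>\<^bsub>H\<^esub>"
    using M(2) aw(1) x by (auto simp: kernel_def)
  then have "w \<in> kernel F H (q \<circ> j)"
    using aw by (simp add: kernel_def)
  moreover have "kernel F H (q \<circ> j) \<subseteq> {w \<in> carrier F. j w \<in> M}"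
    using A M(3) j.normal_preimage[OF M(1)] by blast
  ultimately show "x \<in> M"
    using aw by auto
qed

text \<open>
  The relators are the images of the relators of \<open>H\<close> under a lift \<open>j\<close> of its presentation
  to \<open>E\<close>, together with one relator for each generator of \<open>E\<close>, which identifies it with a word
  in the lifted generators.
\<close>

lemma finitely_presented_kernel:
  assumes fp: "finitely_presented H" and fg: "finitely_generated_group E" and q: "q \<in> epi E H"
  shows "finitely_normally_generated E (kernel E H q)"
proof -
  have "group E" "group H"
    using assms by (auto simp: finitely_generated_group_def finitely_presented_def)
  interpret q: group_hom E H q
    using q \<open>group E\<close> \<open>group H\<close> by (simp add: group_hom_def group_hom_axioms_def epi_def)
  obtain m \<pi> where \<pi>: "\<pi> \<in> epi (free_group m) H"
      "finitely_normally_generated (free_group m) (kernel (free_group m) H \<pi>)"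
    using fp by (auto simp: finitely_presented_def)
  let ?F = "free_group m"
  have \<pi>': "\<pi> \<in> hom ?F H" "\<pi> ` carrier ?F = carrier H"
    using \<pi>(1) by (auto simp: epi_def)
  obtain A where A: "finite A" "A \<subseteq> kernel ?F H \<pi>"
      "\<And>M. M \<lhd> ?F \<Longrightarrow> A \<subseteq> M \<Longrightarrow> kernel ?F H \<pi> \<subseteq> M"
    by (rule finitely_normally_generatedE[OF \<pi>(2)]) (rule that)
  obtain S where S: "finite S" "S \<subseteq> carrier E" "generate E S = carrier E"
    by (rule finitely_generated_groupE[OF fg]) (rule that)
  obtain j where j: "j \<in> hom ?F E" "\<And>w. w \<in> carrier ?F \<Longrightarrow> q (j w) = \<pi> w"
    by (rule free_group_lift[OF \<open>group E\<close> \<open>group H\<close> q \<pi>'(1)]) (rule that)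
  interpret j: group_hom ?F E j
    by (intro group_hom.intro group_hom_axioms.intro group_free_group \<open>group E\<close> j(1))
  have ker_eq: "kernel ?F H (q \<circ> j) = kernel ?F H \<pi>"
    using j(2) by (auto simp: kernel_def)
  have "\<exists>w \<in> carrier ?F. \<pi> w = q e" if "e \<in> S" for e
  proof -
    have "q e \<in> \<pi> ` carrier ?F"
      using that S(2) \<pi>'(2) by auto
    then show ?thesis
      by (metis imageE)
  qed
  then obtain u where u: "\<And>e. e \<in> S \<Longrightarrow> u e \<in> carrier ?F" "\<And>e. e \<in> S \<Longrightarrow> \<pi> (u e) = q e"
    by metis
  define R where "R = j ` A \<union> (\<lambda>e. e \<otimes>\<^bsub>E\<^esub> inv\<^bsub>E\<^esub> j (u e)) ` S"
  have AF: "A \<subseteq> carrier ?F"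
    using A(2) by (auto simp: kernel_def)
  have R: "R \<subseteq> kernel E H q"
    using A(2) S(2) u by (auto simp: R_def kernel_def j(2))
  have "kernel E H q \<subseteq> M" if M: "M \<lhd> E" "R \<subseteq> M" for M
  proof -
    \<comment> \<open>Intersecting with the kernel makes the relations in \<open>M\<close> hold in \<open>H\<close>.\<close>
    let ?M = "M \<inter> kernel E H q"
    have normal: "?M \<lhd> E"
      by (rule q.G.normal_subgroup_intersect[OF M(1) q.normal_kernel])
    interpret P: subgroup "?M <#>\<^bsub>E\<^esub> j ` carrier ?F" E
      by (rule q.G.mult_norm_subgroup[OF normal j.img_is_subgroup])
    have "S \<subseteq> ?M <#>\<^bsub>E\<^esub> j ` carrier ?F"
    proof
      fix e assume e: "e \<in> S"
      have "e \<otimes>\<^bsub>E\<^esub> inv\<^bsub>E\<^esub> j (u e) \<in> ?M"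
        using M(2) R e by (auto simp: R_def)
      moreover have "e = e \<otimes>\<^bsub>E\<^esub> inv\<^bsub>E\<^esub> j (u e) \<otimes>\<^bsub>E\<^esub> j (u e)"
        using e S(2) u(1) by (simp add: q.G.m_assoc subset_eq)
      ultimately show "e \<in> ?M <#>\<^bsub>E\<^esub> j ` carrier ?F"
        using u(1)[OF e] unfolding set_mult_def by blast
    qed
    then have "carrier E \<subseteq> ?M <#>\<^bsub>E\<^esub> j ` carrier ?F"
      using q.G.generate_subgroup_incl[OF _ P.subgroup_axioms] S(3) by blast
    then have "kernel E H q \<subseteq> ?M <#>\<^bsub>E\<^esub> j ` carrier ?F"
      by (auto simp: kernel_def)
    moreover have "j ` A \<subseteq> ?M"
      using M(2) R by (auto simp: R_def)
    ultimately have "kernel E H q \<subseteq> ?M"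
      using kernel_subset_of_cover[OF j.group_hom_axioms q.group_hom_axioms, of A ?M]
        A(3) AF normal ker_eq by simp
    then show ?thesis
      by blast
  qed
  moreover have "finite R"
    using A(1) S(1) by (simp add: R_def)
  ultimately show ?thesis
    using R unfolding finitely_normally_generated_def by blast
qed

section \<open>Extensions of finitely presented groups\<close>

lemma (in group) normal_if_generators_normalize:
  assumes P: "subgroup P G" and S: "S \<subseteq> carrier G" "generate G S = carrier G"
    and conj: "\<And>s x. s \<in> S \<Longrightarrow> x \<in> P \<Longrightarrow> s \<otimes> x \<otimes> inv s \<in> P"
      "\<And>s x. s \<in> S \<Longrightarrow> x \<in> P \<Longrightarrow> inv s \<otimes> x \<otimes> s \<in> P"
  shows "P \<lhd> G"
proof (rule normal_invI[OF P])
  interpret P: subgroup P G by fact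
  fix g h assume g: "g \<in> carrier G" and h: "h \<in> P"
  have "g \<in> generate G S"
    using g S(2) by simp
  then have "\<forall>h \<in> P. g \<otimes> h \<otimes> inv g \<in> P"
  proof induction
    case (inv s)
    then have "s \<in> carrier G"
      using S(1) by blast
    then show ?case
      using conj(2)[OF inv] by simp
  next
    case (eng a b)
    then have ab: "a \<in> carrier G" "b \<in> carrier G"
      using generate_in_carrier[OF S(1)] by auto
    show ?case
    proof
      fix h assume h: "h \<in> P"
      have "a \<otimes> (b \<otimes> h \<otimes> inv b) \<otimes> inv a \<in> P"
        using eng.IH h by blast
      moreover have "a \<otimes> b \<otimes> h \<otimes> inv (a \<otimes> b) = a \<otimes> (b \<otimes> h \<otimes> inv b) \<otimes> inv a"
        using ab P.mem_carrier[OF h] by (simp add: inv_mult_group m_assoc)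
      ultimately show "a \<otimes> b \<otimes> h \<otimes> inv (a \<otimes> b) \<in> P"
        by simp
    qed
  qed (simp_all add: conj(1))
  then show "g \<otimes> h \<otimes> inv g \<in> P"
    using h by blast
qed

lemma finitely_generated_extension:
  assumes ses: "short_exact_sequence K i G p Q"
    and fg: "finitely_generated_group K" "finitely_generated_group Q"
  shows "finitely_generated_group G"
proof -
  have *: "group K" "group G" "group Q" "i \<in> hom K G"
      "p \<in> hom G Q" "p ` carrier G = carrier Q" "i ` carrier K = kernel G Q p"
    using ses by (auto simp: short_exact_sequence_def mon_def epi_def)
  interpret i: group_hom K G i
    by (simp add: group_hom_def group_hom_axioms_def *)
  interpret p: group_hom G Q p
    by (simp add: group_hom_def group_hom_axioms_def *)
  obtain S where S: "finite S" "S \<subseteq> carrier K" "generate K S = carrier K"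
    by (rule finitely_generated_groupE[OF fg(1)]) (rule that)
  obtain T where T: "finite T" "T \<subseteq> carrier Q" "generate Q T = carrier Q"
    by (rule finitely_generated_groupE[OF fg(2)]) (rule that)
  obtain T' where T': "T' \<subseteq> carrier G" "finite T'" "T = p ` T'"
    using finite_subset_image[OF T(1), of p "carrier G"] T(2) *(6) by auto
  let ?S = "i ` S \<union> T'"
  have S_subset: "?S \<subseteq> carrier G"
    using S(2) T'(1) by auto
  interpret V: subgroup "generate G ?S" G
    by (rule i.H.generate_is_subgroup[OF S_subset])
  have "i ` carrier K \<subseteq> generate G ?S"
    using i.generate_img[OF S(2)] S(3) i.H.mono_generate[of "i ` S" ?S] by auto
  then have ker: "kernel G Q p \<subseteq> generate G ?S"
    by (simp add: *)
  have "carrier Q = p ` generate G T'"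
    using p.generate_img[OF T'(1)] T'(3) T(3) by simp
  also have "\<dots> \<subseteq> p ` generate G ?S"
    by (intro image_mono i.H.mono_generate) simp
  finally have im: "carrier Q \<subseteq> p ` generate G ?S" .
  have "carrier G \<subseteq> generate G ?S"
  proof
    fix x assume x: "x \<in> carrier G"
    then have "p x \<in> p ` generate G ?S"
      using im by auto
    then obtain v where v: "p x = p v" "v \<in> generate G ?S"
      by (rule imageE)
    have vc: "v \<in> carrier G"
      using v(2) by simp
    then have "x \<otimes>\<^bsub>G\<^esub> inv\<^bsub>G\<^esub> v \<in> kernel G Q p"
      using x by (simp add: kernel_def v(1))
    then have "x \<otimes>\<^bsub>G\<^esub> inv\<^bsub>G\<^esub> v \<otimes>\<^bsub>G\<^esub> v \<in> generate G ?S"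
      by (rule V.m_closed[OF subsetD[OF ker] v(2)])
    then show "x \<in> generate G ?S"
      using x vc by (simp add: i.H.m_assoc)
  qed
  then show ?thesis
    using S(1) T'(2) S_subset by (intro finitely_generated_groupI[of G ?S] *(2)) auto
qed

text \<open>
  Let \<open>E\<close> be a free group mapping onto \<open>G\<close>, let \<open>F\<close> be the free group of a presentation of \<open>K\<close>,
  realised in \<open>E\<close> by \<open>j\<close>, and let \<open>L\<close> be the preimage of \<open>K\<close> in \<open>E\<close>. As the kernel of a map onto \<open>Q\<close>,
  \<open>L\<close> is the normal closure of a finite set \<open>B\<close>. The relators are those of \<open>K\<close>, and those
  which rewrite the elements of \<open>B\<close> and the conjugates \<open>C\<close> of generators of \<open>j(F)\<close> by generators of
  \<open>E\<close> and their inverses as elements of \<open>j(F)\<close>. Modulo them, \<open>j(F)\<close> is normalised by \<open>E\<close> and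
  contains \<open>B\<close>; so it is all of \<open>L\<close>, and \<open>kernel_subset_of_cover\<close> applies.
\<close>

lemma finitely_presented_extension:
  assumes ses: "short_exact_sequence K i G p Q"
    and fp: "finitely_presented K" "finitely_presented Q"
  shows "finitely_presented G"
proof -
  have *: "group K" "group G" "group Q" "i \<in> hom K G" "inj_on i (carrier K)"
      "p \<in> hom G Q" "p ` carrier G = carrier Q" "i ` carrier K = kernel G Q p"
    using ses by (auto simp: short_exact_sequence_def mon_def epi_def)
  interpret i: group_hom K G i
    by (simp add: group_hom_def group_hom_axioms_def *)
  interpret p: group_hom G Q p
    by (simp add: group_hom_def group_hom_axioms_def *)
  have "finitely_generated_group G"
    by (intro finitely_generated_extension[OF ses] finitely_presented_imp_finitely_generated fp)
  then obtain r \<pi> where \<pi>: "\<pi> \<in> epi (free_group r) G"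
    by (rule finitely_generated_quotient_of_free_group)
  let ?E = "free_group r"
  have \<pi>': "\<pi> \<in> hom ?E G" "\<pi> ` carrier ?E = carrier G"
    using \<pi> by (auto simp: epi_def)
  interpret \<pi>: group_hom ?E G \<pi>
    by (simp add: group_hom_def group_hom_axioms_def * group_free_group \<pi>')
  have "(p \<circ> \<pi>) ` carrier ?E = carrier Q"
    by (simp only: image_comp[symmetric] \<pi>'(2) *(7))
  then have p\<pi>: "p \<circ> \<pi> \<in> epi ?E Q"
    using Group.hom_compose[OF \<pi>'(1) *(6)] unfolding epi_def by blast
  interpret p\<pi>: group_hom ?E Q "p \<circ> \<pi>"
    using p\<pi> by (simp add: group_hom_def group_hom_axioms_def * group_free_group epi_def)
  define L where "L = kernel ?E Q (p \<circ> \<pi>)"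
  interpret L: normal L ?E
    unfolding L_def by (rule p\<pi>.normal_kernel)
  have "finitely_normally_generated ?E L"
    unfolding L_def by (rule finitely_presented_kernel[OF fp(2) finitely_generated_free_group p\<pi>])
  then obtain B where B: "finite B" "B \<subseteq> L" "\<And>M. M \<lhd> ?E \<Longrightarrow> B \<subseteq> M \<Longrightarrow> L \<subseteq> M"
    by (rule finitely_normally_generatedE) (rule that)
  obtain m \<kappa> where \<kappa>: "\<kappa> \<in> epi (free_group m) K"
      "finitely_normally_generated (free_group m) (kernel (free_group m) K \<kappa>)"
    using fp(1) by (auto simp: finitely_presented_def)
  let ?F = "free_group m"
  have \<kappa>': "\<kappa> \<in> hom ?F K" "\<kappa> ` carrier ?F = carrier K"
    using \<kappa>(1) by (auto simp: epi_def)
  interpret \<kappa>: group_hom ?F K \<kappa>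
    by (simp add: group_hom_def group_hom_axioms_def * group_free_group \<kappa>')
  obtain A where A: "finite A" "A \<subseteq> kernel ?F K \<kappa>"
      "\<And>M. M \<lhd> ?F \<Longrightarrow> A \<subseteq> M \<Longrightarrow> kernel ?F K \<kappa> \<subseteq> M"
    by (rule finitely_normally_generatedE[OF \<kappa>(2)]) (rule that)
  have i\<kappa>: "i \<circ> \<kappa> \<in> hom ?F G"
    by (rule Group.hom_compose[OF \<kappa>'(1) *(4)])
  obtain j where j: "j \<in> hom ?F ?E" "\<And>w. w \<in> carrier ?F \<Longrightarrow> \<pi> (j w) = (i \<circ> \<kappa>) w"
    by (rule free_group_lift[OF group_free_group *(2) \<pi> i\<kappa>]) (rule that)
  interpret j: group_hom ?F ?E j
    by (simp add: group_hom_def group_hom_axioms_def group_free_group j)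
  have i_one: "i x = \<one>\<^bsub>G\<^esub> \<longleftrightarrow> x = \<one>\<^bsub>K\<^esub>" if "x \<in> carrier K" for x
    using inj_onD[OF *(5), of x "\<one>\<^bsub>K\<^esub>"] that by auto
  have ker_eq: "kernel ?F G (\<pi> \<circ> j) = kernel ?F K \<kappa>"
    using j(2) by (auto simp: kernel_def i_one)
  have AF: "A \<subseteq> carrier ?F"
    using A(2) by (auto simp: kernel_def)
  have jL: "j w \<in> L" if "w \<in> carrier ?F" for w
  proof -
    have "i (\<kappa> w) \<in> kernel G Q p"
      unfolding *(8)[symmetric] by (rule imageI, rule \<kappa>.hom_closed[OF that])
    then have "p (i (\<kappa> w)) = \<one>\<^bsub>Q\<^esub>"
      unfolding kernel_def by blast
    then have "(p \<circ> \<pi>) (j w) = \<one>\<^bsub>Q\<^esub>"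
      by (simp only: comp_apply j(2)[OF that])
    then show ?thesis
      unfolding L_def kernel_def using j.hom_closed[OF that] by blast
  qed
  have "\<exists>w \<in> carrier ?F. \<pi> (j w) = \<pi> x" if "x \<in> L" for x
  proof -
    have "\<pi> x \<in> i ` carrier K"
      using that unfolding *(8) L_def kernel_def by simp
    then have "\<pi> x \<in> (i \<circ> \<kappa>) ` carrier ?F"
      by (simp only: image_comp[symmetric] \<kappa>'(2))
    then obtain w where "\<pi> x = (i \<circ> \<kappa>) w" "w \<in> carrier ?F"
      by (rule imageE)
    then show ?thesis
      using j(2)[of w] by (intro bexI[of _ w]) simp_all
  qed
  then obtain u where u: "\<And>x. x \<in> L \<Longrightarrow> u x \<in> carrier ?F" "\<And>x. x \<in> L \<Longrightarrow> \<pi> (j (u x)) = \<pi> x"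
    by metis
  define T where "T = free_generators r \<union> m_inv ?E ` free_generators r"
  define C where "C = (\<lambda>(t, x). t \<otimes>\<^bsub>?E\<^esub> j x \<otimes>\<^bsub>?E\<^esub> inv\<^bsub>?E\<^esub> t) ` (T \<times> free_generators m)"
  have T: "T \<subseteq> carrier ?E"
    using free_generators_subset[of r] by (auto simp: T_def)
  have C: "C \<subseteq> L"
    unfolding C_def using T free_generators_subset[of m]
    by (auto intro!: L.inv_op_closed2 jL)
  define R where "R = j ` A \<union> (\<lambda>x. x \<otimes>\<^bsub>?E\<^esub> inv\<^bsub>?E\<^esub> j (u x)) ` (B \<union> C)"
  have fin_gens: "finite (free_generators n)" for n
    by (simp add: free_generators_def)
  have "finite R"
    using A(1) B(1) fin_gens by (simp add: R_def C_def T_def)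
  moreover have R: "R \<subseteq> kernel ?E G \<pi>"
  proof -
    have "x \<otimes>\<^bsub>?E\<^esub> inv\<^bsub>?E\<^esub> j (u x) \<in> kernel ?E G \<pi>" if "x \<in> L" for x
      using that u by (simp add: kernel_def)
    moreover have "j a \<in> kernel ?E G \<pi>" if "a \<in> A" for a
      using A(2) that by (auto simp: kernel_def j(2))
    ultimately show ?thesis
      using B(2) C by (auto simp: R_def)
  qed
  moreover have "kernel ?E G \<pi> \<subseteq> M" if M: "M \<lhd> ?E" "R \<subseteq> M" for M
  proof -
    \<comment> \<open>Intersecting with the kernel makes the relations in \<open>M\<close> hold in \<open>G\<close>.\<close>
    let ?M = "M \<inter> kernel ?E G \<pi>"
    let ?P = "?M <#>\<^bsub>?E\<^esub> j ` carrier ?F"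
    have normal: "?M \<lhd> ?E"
      by (rule \<pi>.G.normal_subgroup_intersect[OF M(1) \<pi>.normal_kernel])
    interpret M: normal ?M ?E by fact
    interpret P: subgroup ?P ?E
      by (rule \<pi>.G.mult_norm_subgroup[OF normal j.img_is_subgroup])
    have M_P: "x \<in> ?P" if "x \<in> ?M" for x
    proof -
      have "x = x \<otimes>\<^bsub>?E\<^esub> j \<one>\<^bsub>?F\<^esub>"
        using that by simp
      then show ?thesis
        using that \<kappa>.G.one_closed unfolding set_mult_def by blast
    qed
    have BC: "x \<in> ?P" if x: "x \<in> B \<union> C" for x
    proof -
      have "x \<in> L"
        using x B(2) C by blast
      have "x \<otimes>\<^bsub>?E\<^esub> inv\<^bsub>?E\<^esub> j (u x) \<in> ?M"
        using x M(2) R by (auto simp: R_def)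
      moreover have "x = x \<otimes>\<^bsub>?E\<^esub> inv\<^bsub>?E\<^esub> j (u x) \<otimes>\<^bsub>?E\<^esub> j (u x)"
        using \<open>x \<in> L\<close> u(1) by (simp add: \<pi>.G.m_assoc)
      ultimately show ?thesis
        using u(1)[OF \<open>x \<in> L\<close>] unfolding set_mult_def by blast
    qed
    \<comment> \<open>For fixed \<open>t\<close> the words \<open>w\<close> with this property form a subgroup, which contains the
      generators by the relators coming from \<open>C\<close>.\<close>
    have conj_j: "t \<otimes>\<^bsub>?E\<^esub> j w \<otimes>\<^bsub>?E\<^esub> inv\<^bsub>?E\<^esub> t \<in> ?P" if t: "t \<in> T" and w: "w \<in> carrier ?F" for t w
    proof -
      have tc: "t \<in> carrier ?E"
        using t T by blast
      have "subgroup {w \<in> carrier ?F. t \<otimes>\<^bsub>?E\<^esub> j w \<otimes>\<^bsub>?E\<^esub> inv\<^bsub>?E\<^esub> t \<in> ?P} ?F" (is "subgroup ?W ?F")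
      proof (rule \<kappa>.G.subgroupI)
        have "\<one>\<^bsub>?F\<^esub> \<in> ?W"
          using tc by simp
        then show "?W \<noteq> {}"
          by blast
        show "inv\<^bsub>?F\<^esub> a \<in> ?W" if "a \<in> ?W" for a
        proof -
          have a: "a \<in> carrier ?F" "t \<otimes>\<^bsub>?E\<^esub> j a \<otimes>\<^bsub>?E\<^esub> inv\<^bsub>?E\<^esub> t \<in> ?P"
            using that by auto
          have "inv\<^bsub>?E\<^esub> (t \<otimes>\<^bsub>?E\<^esub> j a \<otimes>\<^bsub>?E\<^esub> inv\<^bsub>?E\<^esub> t) = t \<otimes>\<^bsub>?E\<^esub> j (inv\<^bsub>?F\<^esub> a) \<otimes>\<^bsub>?E\<^esub> inv\<^bsub>?E\<^esub> t"
            using a(1) tc by (simp add: \<pi>.G.inv_mult_group \<pi>.G.m_assoc)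
          then show ?thesis
            using P.m_inv_closed[OF a(2)] a(1) by simp
        qed
        show "a \<otimes>\<^bsub>?F\<^esub> b \<in> ?W" if "a \<in> ?W" "b \<in> ?W" for a b
        proof -
          have ab: "a \<in> carrier ?F" "t \<otimes>\<^bsub>?E\<^esub> j a \<otimes>\<^bsub>?E\<^esub> inv\<^bsub>?E\<^esub> t \<in> ?P"
            "b \<in> carrier ?F" "t \<otimes>\<^bsub>?E\<^esub> j b \<otimes>\<^bsub>?E\<^esub> inv\<^bsub>?E\<^esub> t \<in> ?P"
            using that by auto
          have "t \<otimes>\<^bsub>?E\<^esub> j (a \<otimes>\<^bsub>?F\<^esub> b) \<otimes>\<^bsub>?E\<^esub> inv\<^bsub>?E\<^esub> t =
              t \<otimes>\<^bsub>?E\<^esub> j a \<otimes>\<^bsub>?E\<^esub> (inv\<^bsub>?E\<^esub> t \<otimes>\<^bsub>?E\<^esub> t) \<otimes>\<^bsub>?E\<^esub> j b \<otimes>\<^bsub>?E\<^esub> inv\<^bsub>?E\<^esub> t"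
            using ab tc by (simp add: \<pi>.G.m_assoc)
          also have "\<dots> = (t \<otimes>\<^bsub>?E\<^esub> j a \<otimes>\<^bsub>?E\<^esub> inv\<^bsub>?E\<^esub> t) \<otimes>\<^bsub>?E\<^esub> (t \<otimes>\<^bsub>?E\<^esub> j b \<otimes>\<^bsub>?E\<^esub> inv\<^bsub>?E\<^esub> t)"
            using ab(1,3) tc by (simp only: \<pi>.G.m_assoc j.hom_closed \<pi>.G.inv_closed \<pi>.G.m_closed)
          finally show ?thesis
            using P.m_closed[OF ab(2,4)] ab(1,3) by simp
        qed
      qed blast
      moreover have "free_generators m \<subseteq> ?W"
        using BC t free_generators_subset[of m] by (auto simp: C_def)
      ultimately have "generate ?F (free_generators m) \<subseteq> ?W"
        by (intro \<kappa>.G.generate_subgroup_incl)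
      then show ?thesis
        using w by (auto simp: generate_free_generators)
    qed
    have conj: "t \<otimes>\<^bsub>?E\<^esub> x \<otimes>\<^bsub>?E\<^esub> inv\<^bsub>?E\<^esub> t \<in> ?P" if t: "t \<in> T" and x: "x \<in> ?P" for t x
    proof -
      have tc: "t \<in> carrier ?E"
        using t T by blast
      obtain a w where aw: "a \<in> ?M" "w \<in> carrier ?F" "x = a \<otimes>\<^bsub>?E\<^esub> j w"
        using x unfolding set_mult_def by blast
      have "t \<otimes>\<^bsub>?E\<^esub> a \<otimes>\<^bsub>?E\<^esub> inv\<^bsub>?E\<^esub> t \<in> ?P"
        by (intro M_P M.inv_op_closed2 tc aw)
      moreover have "t \<otimes>\<^bsub>?E\<^esub> x \<otimes>\<^bsub>?E\<^esub> inv\<^bsub>?E\<^esub> t =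
          (t \<otimes>\<^bsub>?E\<^esub> a \<otimes>\<^bsub>?E\<^esub> inv\<^bsub>?E\<^esub> t) \<otimes>\<^bsub>?E\<^esub> (t \<otimes>\<^bsub>?E\<^esub> j w \<otimes>\<^bsub>?E\<^esub> inv\<^bsub>?E\<^esub> t)"
      proof -
        have ac: "a \<in> carrier ?E" "j w \<in> carrier ?E"
          using aw(1,2) M.mem_carrier j.hom_closed by auto
        have "(t \<otimes>\<^bsub>?E\<^esub> a \<otimes>\<^bsub>?E\<^esub> inv\<^bsub>?E\<^esub> t) \<otimes>\<^bsub>?E\<^esub> (t \<otimes>\<^bsub>?E\<^esub> j w \<otimes>\<^bsub>?E\<^esub> inv\<^bsub>?E\<^esub> t) =
            t \<otimes>\<^bsub>?E\<^esub> a \<otimes>\<^bsub>?E\<^esub> (inv\<^bsub>?E\<^esub> t \<otimes>\<^bsub>?E\<^esub> t) \<otimes>\<^bsub>?E\<^esub> j w \<otimes>\<^bsub>?E\<^esub> inv\<^bsub>?E\<^esub> t"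
          using ac tc by (simp only: \<pi>.G.m_assoc \<pi>.G.inv_closed \<pi>.G.m_closed)
        then show ?thesis
          using ac tc aw(3) by (simp add: \<pi>.G.m_assoc)
      qed
      ultimately show ?thesis
        using P.m_closed conj_j[OF t aw(2)] by simp
    qed
    have "?P \<lhd> ?E"
    proof (rule \<pi>.G.normal_if_generators_normalize[OF P.subgroup_axioms free_generators_subset generate_free_generators])
      fix s x assume s: "s \<in> free_generators r" and x: "x \<in> ?P"
      have sc: "s \<in> carrier ?E"
        using s free_generators_subset by blast
      show "s \<otimes>\<^bsub>?E\<^esub> x \<otimes>\<^bsub>?E\<^esub> inv\<^bsub>?E\<^esub> s \<in> ?P"
        by (rule conj[OF _ x]) (simp add: T_def s)
      have "inv\<^bsub>?E\<^esub> s \<in> T"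
        using s by (simp add: T_def)
      then show "inv\<^bsub>?E\<^esub> s \<otimes>\<^bsub>?E\<^esub> x \<otimes>\<^bsub>?E\<^esub> s \<in> ?P"
        using conj[OF _ x, of "inv\<^bsub>?E\<^esub> s"] sc by simp
    qed
    then have "L \<subseteq> ?P"
      by (rule B(3)) (use BC in blast)
    moreover have "kernel ?E G \<pi> \<subseteq> L"
    proof
      fix x assume "x \<in> kernel ?E G \<pi>"
      then have x: "x \<in> carrier ?E" "\<pi> x = \<one>\<^bsub>G\<^esub>"
        unfolding kernel_def by blast+
      then have "(p \<circ> \<pi>) x = \<one>\<^bsub>Q\<^esub>"
        by (simp only: comp_apply p.hom_one)
      then show "x \<in> L"
        unfolding L_def kernel_def using x(1) by blast
    qed
    ultimately have "kernel ?E G \<pi> \<subseteq> ?P"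
      by simp
    moreover have "j ` A \<subseteq> ?M"
      using M(2) R by (auto simp: R_def)
    ultimately have "kernel ?E G \<pi> \<subseteq> ?M"
      using kernel_subset_of_cover[OF j.group_hom_axioms \<pi>.group_hom_axioms, of A ?M]
        A(3) AF normal ker_eq by simp
    then show ?thesis
      by blast
  qed
  ultimately have "finitely_normally_generated ?E (kernel ?E G \<pi>)"
    unfolding finitely_normally_generated_def by blast
  then show ?thesis
    unfolding finitely_presented_def using *(2) \<pi> by blast
qed

section \<open>Finite-index overgroups of finitely presented groups\<close>

text \<open>
  Schreier's argument, with an arbitrary finite set \<open>T\<close> of coset representatives: right
  multiplication by a generator carries \<open>v t\<close> to \<open>v (t s t'\<^sup>-\<^sup>1) t'\<close>, so the products of
  elements of \<open>V\<close> and representatives exhaust the group. Representatives in \<open>U\<close> itself are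
  added to the generators, since \<open>T\<close> need not represent every coset only once.
\<close>

lemma (in group) finitely_generated_finite_index_subgroup:
  assumes fg: "finitely_generated_group G" and U: "subgroup U G"
    and T: "finite T" "T \<subseteq> carrier G" "\<And>x. x \<in> carrier G \<Longrightarrow> \<exists>t \<in> T. x \<otimes> inv t \<in> U"
  shows "finitely_generated_group (G\<lparr>carrier := U\<rparr>)"
proof -
  interpret U: subgroup U G by fact
  obtain S where S: "finite S" "S \<subseteq> carrier G" "generate G S = carrier G"
    by (rule finitely_generated_groupE[OF fg]) (rule that)
  define S' where "S' = S \<union> m_inv G ` S"
  define T' where "T' = insert \<one> T"
  define Y where "Y = ((\<lambda>(t, s, t'). t \<otimes> s \<otimes> inv t') ` (T' \<times> S' \<times> T') \<union> T') \<inter> U"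
  have S': "finite S'" "S' \<subseteq> carrier G"
    using S by (auto simp: S'_def)
  have T': "finite T'" "T' \<subseteq> carrier G"
    using T by (auto simp: T'_def)
  have "finite Y"
    using S'(1) T'(1) by (simp add: Y_def)
  have YU: "Y \<subseteq> U"
    by (simp add: Y_def)
  then have Yc: "Y \<subseteq> carrier G"
    using U.subset by blast
  define V where "V = generate G Y"
  interpret V: subgroup V G
    unfolding V_def by (rule generate_is_subgroup[OF Yc])
  have Y_V: "y \<in> V" if "y \<in> Y" for y
    unfolding V_def using that by (rule generate.incl)
  have VU: "V \<subseteq> U"
    unfolding V_def by (rule generate_subgroup_incl[OF YU U])
  have step: "y \<otimes> s \<in> V <#> T'" if y: "y \<in> V <#> T'" and s: "s \<in> S'" for y s
  proof -
    obtain v t where vt: "v \<in> V" "t \<in> T'" "y = v \<otimes> t"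
      using y unfolding set_mult_def by blast
    have c: "v \<in> carrier G" "t \<in> carrier G" "s \<in> carrier G"
      using vt(1,2) s S'(2) T'(2) by auto
    obtain t' where t': "t' \<in> T" "t \<otimes> s \<otimes> inv t' \<in> U"
      using T(3)[of "t \<otimes> s"] c by auto
    have t'': "t' \<in> T'" "t' \<in> carrier G"
      using t'(1) T(2) by (auto simp: T'_def)
    have "t \<otimes> s \<otimes> inv t' \<in> (\<lambda>(t, s, t'). t \<otimes> s \<otimes> inv t') ` (T' \<times> S' \<times> T')"
      by (rule image_eqI[of _ _ "(t, s, t')"]) (simp_all add: vt(2) s t''(1))
    then have "t \<otimes> s \<otimes> inv t' \<in> Y"
      using t'(2) unfolding Y_def by blast
    then have "v \<otimes> (t \<otimes> s \<otimes> inv t') \<in> V"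
      by (rule V.m_closed[OF vt(1) Y_V])
    moreover have "y \<otimes> s = v \<otimes> (t \<otimes> s \<otimes> inv t') \<otimes> t'"
      using c t''(2) by (simp add: vt(3) m_assoc)
    ultimately show ?thesis
      using t''(1) unfolding set_mult_def by blast
  qed
  have VT: "y \<in> carrier G" if "y \<in> V <#> T'" for y
    using that T'(2) by (auto simp: set_mult_def)
  have "\<forall>y \<in> V <#> T'. y \<otimes> x \<in> V <#> T'" if "x \<in> generate G S" for x
    using that
  proof induction
    case one
    then show ?case
      using VT by simp
  next
    case (incl s)
    then show ?case
      using step by (simp add: S'_def)
  next
    case (inv s)
    then show ?case
      using step by (simp add: S'_def)
  next
    case (eng a b)
    have "a \<in> carrier G" "b \<in> carrier G"
      using eng.hyps S(3) by auto
    then have "y \<otimes> (a \<otimes> b) = y \<otimes> a \<otimes> b" if "y \<in> V <#> T'" for y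
      using VT[OF that] by (simp add: m_assoc)
    then show ?case
      using eng.IH by simp
  qed
  moreover have one: "\<one> \<in> V <#> T'"
    unfolding set_mult_def using V.one_closed by (auto simp: T'_def intro!: bexI[of _ "\<one>"])
  ultimately have cover: "x \<in> V <#> T'" if "x \<in> carrier G" for x
    using that S(3) by (metis l_one)
  have "U \<subseteq> V"
  proof
    fix x assume x: "x \<in> U"
    then obtain v t where vt: "v \<in> V" "t \<in> T'" "x = v \<otimes> t"
      using cover[of x] unfolding set_mult_def by auto
    have c: "v \<in> carrier G" "t \<in> carrier G"
      using vt(1,2) T'(2) by auto
    have "t = inv v \<otimes> x"
      using c by (simp add: vt(3) m_assoc[symmetric])
    moreover have "inv v \<in> U"
      using VU vt(1) by (intro U.m_inv_closed) blast
    ultimately have "t \<in> U"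
      using x by simp
    then have "t \<in> Y"
      using vt(2) by (simp add: Y_def)
    then show "x \<in> V"
      using vt(1) Y_V by (simp add: vt(3))
  qed
  then have "U \<subseteq> generate (G\<lparr>carrier := U\<rparr>) Y"
    unfolding generate_consistent[OF YU U] V_def .
  then show ?thesis
    by (intro finitely_generated_groupI[of _ Y] subgroup_imp_group[OF U] \<open>finite Y\<close>)
       (simp_all add: YU)
qed

lemma (in group) finite_coset_representatives:
  assumes "subgroup H G" "finite (rcosets H)"
  obtains T where "finite T" "T \<subseteq> carrier G" "\<And>x. x \<in> carrier G \<Longrightarrow> \<exists>t \<in> T. x \<otimes> inv t \<in> H"
proof -
  interpret H: subgroup H G by fact
  have rcosets_eq: "rcosets H = (\<lambda>x. H #> x) ` carrier G"
    by (auto simp: RCOSETS_def)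
  obtain T where T: "T \<subseteq> carrier G" "finite T" "rcosets H = (\<lambda>x. H #> x) ` T"
    using finite_subset_image[OF assms(2), of "\<lambda>x. H #> x" "carrier G"] rcosets_eq by auto
  have "\<exists>t \<in> T. x \<otimes> inv t \<in> H" if x: "x \<in> carrier G" for x
  proof -
    have "H #> x \<in> (\<lambda>x. H #> x) ` T"
      using x rcosetsI[OF H.subset] T(3) by simp
    then obtain t where t: "t \<in> T" "H #> x = H #> t"
      by blast
    have "x \<in> H #> t"
      using rcos_self[OF x assms(1)] t(2) by simp
    then have "x \<otimes> inv t \<in> H"
      using H.rcos_module_imp[OF is_group] t(1) T(1) by blast
    then show ?thesis
      using t(1) by blast
  qed
  then show thesis
    using that T(1,2) by blast
qed

lemma (in group) finitely_generated_overgroup: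
  assumes H: "subgroup H G" "finite (rcosets H)"
    and fg: "finitely_generated_group (G\<lparr>carrier := H\<rparr>)"
  shows "finitely_generated_group G"
proof -
  interpret H: subgroup H G by fact
  obtain T where T: "finite T" "T \<subseteq> carrier G" "\<And>x. x \<in> carrier G \<Longrightarrow> \<exists>t \<in> T. x \<otimes> inv t \<in> H"
    by (rule finite_coset_representatives[OF H]) (rule that)
  obtain S where S: "finite S" "S \<subseteq> H" "generate (G\<lparr>carrier := H\<rparr>) S = H"
    by (rule finitely_generated_groupE[OF fg]) (rule that, simp_all)
  have gen: "generate G S = H"
    using generate_consistent[OF S(2) H(1)] S(3) by simp
  have c: "S \<union> T \<subseteq> carrier G"
    using S(2) T(2) H.subset by blast
  interpret V: subgroup "generate G (S \<union> T)" G
    by (rule generate_is_subgroup[OF c])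
  have H_V: "H \<subseteq> generate G (S \<union> T)"
    unfolding gen[symmetric] by (rule mono_generate) simp
  have "carrier G \<subseteq> generate G (S \<union> T)"
  proof
    fix x assume x: "x \<in> carrier G"
    then obtain t where t: "t \<in> T" "x \<otimes> inv t \<in> H"
      using T(3) by blast
    have "t \<in> generate G (S \<union> T)"
      using t(1) by (intro generate.incl) simp
    then have "x \<otimes> inv t \<otimes> t \<in> generate G (S \<union> T)"
      by (rule V.m_closed[OF subsetD[OF H_V t(2)]])
    moreover have "t \<in> carrier G"
      using t(1) T(2) by blast
    ultimately show "x \<in> generate G (S \<union> T)"
      using x by (simp add: m_assoc)
  qed
  then show ?thesis
    using finitely_generated_groupI[OF is_group _ c] S(1) T(1) by simp
qed

text \<open>
  The preimage \<open>U\<close> of \<open>H\<close> in a free group mapping onto \<open>G\<close> is finitely generated, and the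
  maps onto \<open>G\<close> and onto \<open>H\<close> have the same kernel. This kernel is the normal closure in \<open>U\<close>, and a
  fortiori in the whole free group, of a finite set.
\<close>

lemma (in group) finitely_presented_overgroup:
  assumes H: "subgroup H G" "finite (rcosets H)"
    and fp: "finitely_presented (G\<lparr>carrier := H\<rparr>)"
  shows "finitely_presented G"
proof -
  interpret H: subgroup H G by fact
  have "finitely_generated_group G"
    by (rule finitely_generated_overgroup[OF H finitely_presented_imp_finitely_generated[OF fp]])
  then obtain r \<pi> where \<pi>: "\<pi> \<in> epi (free_group r) G"
    by (rule finitely_generated_quotient_of_free_group)
  let ?E = "free_group r"
  have \<pi>': "\<pi> \<in> hom ?E G" "\<pi> ` carrier ?E = carrier G"
    using \<pi> by (auto simp: epi_def)
  interpret \<pi>: group_hom ?E G \<pi>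
    by (simp add: group_hom_def group_hom_axioms_def is_group group_free_group \<pi>')
  define U where "U = {x \<in> carrier ?E. \<pi> x \<in> H}"
  have U: "subgroup U ?E"
  proof (rule \<pi>.G.subgroupI)
    have "\<one>\<^bsub>?E\<^esub> \<in> U"
      by (simp add: U_def)
    then show "U \<noteq> {}"
      by blast
  qed (auto simp: U_def)
  obtain T where T: "finite T" "T \<subseteq> carrier G" "\<And>x. x \<in> carrier G \<Longrightarrow> \<exists>t \<in> T. x \<otimes> inv t \<in> H"
    by (rule finite_coset_representatives[OF H]) (rule that)
  obtain T' where T': "T' \<subseteq> carrier ?E" "finite T'" "T = \<pi> ` T'"
    using finite_subset_image[OF T(1), of \<pi> "carrier ?E"] T(2) \<pi>'(2) by auto
  have T'_cover: "\<exists>t \<in> T'. x \<otimes>\<^bsub>?E\<^esub> inv\<^bsub>?E\<^esub> t \<in> U" if x: "x \<in> carrier ?E" for x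
  proof -
    obtain t where t: "t \<in> T'" "\<pi> x \<otimes> inv (\<pi> t) \<in> H"
      using T(3)[OF \<pi>.hom_closed[OF x]] T'(3) by auto
    then have "x \<otimes>\<^bsub>?E\<^esub> inv\<^bsub>?E\<^esub> t \<in> U"
      using x T'(1) by (auto simp: U_def)
    then show ?thesis
      using t(1) by blast
  qed
  have fg: "finitely_generated_group (?E\<lparr>carrier := U\<rparr>)"
    by (rule \<pi>.G.finitely_generated_finite_index_subgroup[OF finitely_generated_free_group U T'(2,1) T'_cover])
  have "\<pi> ` U = H"
  proof
    show "H \<subseteq> \<pi> ` U"
    proof
      fix h assume h: "h \<in> H"
      then have "h \<in> \<pi> ` carrier ?E"
        using \<pi>'(2) H.subset by blast
      then show "h \<in> \<pi> ` U"
        using h by (auto simp: U_def)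
    qed
  qed (auto simp: U_def)
  moreover have "\<pi> \<in> hom (?E\<lparr>carrier := U\<rparr>) (G\<lparr>carrier := H\<rparr>)"
    by (rule homI) (auto simp: U_def)
  ultimately have "\<pi> \<in> epi (?E\<lparr>carrier := U\<rparr>) (G\<lparr>carrier := H\<rparr>)"
    by (simp add: epi_def)
  then have "finitely_normally_generated (?E\<lparr>carrier := U\<rparr>)
      (kernel (?E\<lparr>carrier := U\<rparr>) (G\<lparr>carrier := H\<rparr>) \<pi>)"
    by (rule finitely_presented_kernel[OF fp fg])
  moreover have "kernel (?E\<lparr>carrier := U\<rparr>) (G\<lparr>carrier := H\<rparr>) \<pi> = kernel ?E G \<pi>"
    by (auto simp: kernel_def U_def)
  ultimately have "finitely_normally_generated (?E\<lparr>carrier := U\<rparr>) (kernel ?E G \<pi>)"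
    by simp
  then obtain A where A: "finite A" "A \<subseteq> kernel ?E G \<pi>"
      "\<And>M. M \<lhd> ?E\<lparr>carrier := U\<rparr> \<Longrightarrow> A \<subseteq> M \<Longrightarrow> kernel ?E G \<pi> \<subseteq> M"
    by (rule finitely_normally_generatedE) (rule that)
  have AU: "A \<subseteq> U"
    using A(2) by (auto simp: kernel_def U_def)
  have "kernel ?E G \<pi> \<subseteq> M" if "M \<lhd> ?E" "A \<subseteq> M" for M
    using A(3)[OF \<pi>.G.normal_Int_subgroup[OF U that(1)]] that(2) AU by blast
  then have "finitely_normally_generated ?E (kernel ?E G \<pi>)"
    using A(1,2) unfolding finitely_normally_generated_def by blast
  then show ?thesis
    unfolding finitely_presented_def using is_group \<pi> by blast
qed

section \<open>Isolated points and isolated groups\<close>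

text \<open>
  Basic open sets of the product topology constrain finitely many coordinates, so \<open>N\<close> is isolated
  precisely when membership of finitely many elements determines it among normal subgroups.
\<close>

lemma (in group) open_normal_subgroup_singleton_iff:
  "openin (normal_subgroups_topology G) {N} \<longleftrightarrow>
     N \<lhd> G \<and> (\<exists>D. finite D \<and> D \<subseteq> carrier G \<and> (\<forall>M. M \<lhd> G \<and> M \<inter> D = N \<inter> D \<longrightarrow> M = N))"
    (is "?open \<longleftrightarrow> ?determined")
proof
  let ?\<chi> = "\<lambda>N. \<lambda>x \<in> carrier G. x \<in> N"
  let ?X = "product_topology (\<lambda>_. discrete_topology (UNIV :: bool set)) (carrier G)"
  have sub: "M \<subseteq> carrier G" if "M \<lhd> G" for M
    using that by (rule subgroup.subset[OF normal_imp_subgroup])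
  {
    assume ?open
    then obtain W where W: "openin ?X W" "{N} = ?\<chi> -` W \<inter> {N. N \<lhd> G}"
      unfolding normal_subgroups_topology_def openin_pullback_topology by blast
    then have N: "N \<lhd> G" "?\<chi> N \<in> W"
      by blast+
    then obtain B where B: "finite {x \<in> carrier G. B x \<noteq> (UNIV :: bool set)}"
        "?\<chi> N \<in> Pi\<^sub>E (carrier G) B" "Pi\<^sub>E (carrier G) B \<subseteq> W"
      using W(1) unfolding openin_product_topology_alt by auto
    define D where "D = {x \<in> carrier G. B x \<noteq> (UNIV :: bool set)}"
    have "M = N" if M: "M \<lhd> G" "M \<inter> D = N \<inter> D" for M
    proof -
      have "(x \<in> M) \<in> B x" if x: "x \<in> carrier G" for x
      proof (cases "x \<in> D")
        case True
        then have "(x \<in> M) = (x \<in> N)"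
          using M(2) by blast
        moreover have "(x \<in> N) \<in> B x"
          using PiE_mem[OF B(2) x] x by simp
        ultimately show ?thesis
          by simp
      qed (use x in \<open>simp add: D_def\<close>)
      then have "?\<chi> M \<in> W"
        using B(3) by auto
      then show "M = N"
        using W(2) M(1) by blast
    qed
    moreover have "finite D" "D \<subseteq> carrier G"
      using B(1) by (auto simp: D_def)
    ultimately show ?determined
      using N(1) by blast
  }
  assume ?determined
  then obtain D where D: "N \<lhd> G" "finite D" "D \<subseteq> carrier G"
      "\<And>M. M \<lhd> G \<Longrightarrow> M \<inter> D = N \<inter> D \<Longrightarrow> M = N"
    by blast
  define B where "B x = (if x \<in> D then {x \<in> N} else UNIV)" for x
  have "openin ?X (Pi\<^sub>E (carrier G) B)"
    unfolding openin_PiE_gen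
  proof (intro disjI2 conjI ballI)
    show "finite {x \<in> carrier G. B x \<noteq> topspace (discrete_topology UNIV)}"
      by (rule finite_subset[OF _ D(2)]) (auto simp: B_def)
  qed simp
  moreover have "{N} = ?\<chi> -` Pi\<^sub>E (carrier G) B \<inter> {N. N \<lhd> G}"
  proof
    show "{N} \<subseteq> ?\<chi> -` Pi\<^sub>E (carrier G) B \<inter> {N. N \<lhd> G}"
      using D(1) by (auto simp: B_def)
    show "?\<chi> -` Pi\<^sub>E (carrier G) B \<inter> {N. N \<lhd> G} \<subseteq> {N}"
    proof
      fix M assume "M \<in> ?\<chi> -` Pi\<^sub>E (carrier G) B \<inter> {N. N \<lhd> G}"
      then have M: "?\<chi> M \<in> Pi\<^sub>E (carrier G) B" "M \<lhd> G"
        by auto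
      have "(x \<in> M) = (x \<in> N)" if x: "x \<in> D" for x
        using PiE_mem[OF M(1) subsetD[OF D(3) x]] x subsetD[OF D(3) x] by (simp add: B_def)
      then have "M \<inter> D = N \<inter> D"
        by blast
      then show "M \<in> {N}"
        using D(4) M(2) by simp
    qed
  qed
  ultimately show ?open
    unfolding normal_subgroups_topology_def openin_pullback_topology by blast
qed

text \<open>
  Let \<open>D\<close> be a finite set that determines \<open>N\<close>. A normal \<open>M\<close> containing \<open>N \<inter> D\<close> satisfies
  \<open>M \<inter> N \<inter> D = N \<inter> D\<close>, so \<open>N \<subseteq> M\<close>, and \<open>N \<inter> D\<close> is a set of relators; the preimage of a
  non-trivial normal subgroup differs from \<open>N\<close> on \<open>D\<close>, hence the image of \<open>D - N\<close> is discriminating.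
  Conversely, relators together with lifts of discriminating elements determine \<open>N\<close>.
\<close>

lemma isolated_group_iff_finitely_presented_finitely_discriminable:
  "isolated_group G \<longleftrightarrow> finitely_presented G \<and> finitely_discriminable G"
proof
  assume iso: "isolated_group G"
  interpret G: group G
    using iso by (simp add: isolated_group_def finitely_generated_group_def)
  obtain m N where N: "N \<lhd> free_group m" "free_group m Mod N \<cong> G"
      "openin (normal_subgroups_topology (free_group m)) {N}"
    using iso unfolding isolated_group_def by blast
  let ?F = "free_group m"
  interpret N: normal N ?F by fact
  obtain \<phi> where \<phi>: "\<phi> \<in> iso (?F Mod N) G"
    using N(2) by (auto simp: is_iso_def)
  define \<pi> where "\<pi> = \<phi> \<circ> (\<lambda>x. N #>\<^bsub>?F\<^esub> x)"
  have \<phi>h: "\<phi> \<in> hom (?F Mod N) G" "bij_betw \<phi> (carrier (?F Mod N)) (carrier G)"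
    using \<phi> by (auto simp: iso_def)
  have "\<pi> \<in> hom ?F G"
    unfolding \<pi>_def by (rule Group.hom_compose[OF N.r_coset_hom_Mod \<phi>h(1)])
  have carr: "carrier (?F Mod N) = (\<lambda>x. N #>\<^bsub>?F\<^esub> x) ` carrier ?F"
    by (auto simp: FactGroup_def RCOSETS_def)
  have surj: "\<pi> ` carrier ?F = carrier G"
    unfolding \<pi>_def image_comp[symmetric] carr[symmetric] by (rule bij_betw_imp_surj_on[OF \<phi>h(2)])
  interpret \<pi>: group_hom ?F G \<pi>
    by (simp add: group_hom_def group_hom_axioms_def G.is_group group_free_group \<open>\<pi> \<in> hom ?F G\<close>)
  have ker: "kernel ?F G \<pi> = N"
  proof -
    interpret \<phi>: group_hom "?F Mod N" G \<phi>
      by (simp add: group_hom_def group_hom_axioms_def G.is_group N.factorgroup_is_group \<phi>h(1))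
    have "\<phi> N = \<one>\<^bsub>G\<^esub>"
      using \<phi>.hom_one by (simp add: FactGroup_def)
    have one: "N \<in> carrier (?F Mod N)"
      using \<phi>.G.one_closed by (simp add: FactGroup_def)
    have "\<pi> x = \<one>\<^bsub>G\<^esub> \<longleftrightarrow> x \<in> N" if x: "x \<in> carrier ?F" for x
    proof -
      have xc: "N #>\<^bsub>?F\<^esub> x \<in> carrier (?F Mod N)"
        using x carr by blast
      have "\<pi> x = \<one>\<^bsub>G\<^esub> \<longleftrightarrow> \<phi> (N #>\<^bsub>?F\<^esub> x) = \<phi> N"
        by (simp add: \<pi>_def \<open>\<phi> N = \<one>\<^bsub>G\<^esub>\<close>)
      also have "\<dots> \<longleftrightarrow> N #>\<^bsub>?F\<^esub> x = N"
        by (rule inj_on_eq_iff[OF bij_betw_imp_inj_on[OF \<phi>h(2)] xc one])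
      also have "\<dots> \<longleftrightarrow> x \<in> N"
        using N.coset_join1[OF _ x N.subgroup_axioms] N.coset_join2[OF x N.subgroup_axioms]
          N.subset by blast
      finally show ?thesis .
    qed
    then show ?thesis
      using N.subset by (auto simp: kernel_def)
  qed
  obtain D where D: "finite D" "D \<subseteq> carrier ?F" "\<And>M. M \<lhd> ?F \<Longrightarrow> M \<inter> D = N \<inter> D \<Longrightarrow> M = N"
    using N(3) unfolding N.open_normal_subgroup_singleton_iff by blast
  have "N \<subseteq> M" if M: "M \<lhd> ?F" "N \<inter> D \<subseteq> M" for M
  proof -
    have "M \<inter> N = N"
      by (rule D(3)[OF N.normal_subgroup_intersect[OF M(1) N(1)]]) (use M(2) in blast)
    then show ?thesis
      by blast
  qed
  then have "finitely_normally_generated ?F N"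
    unfolding finitely_normally_generated_def using D(1) by (intro exI[of _ "N \<inter> D"]) simp
  moreover have "\<pi> \<in> epi ?F G"
    using surj \<open>\<pi> \<in> hom ?F G\<close> by (simp add: epi_def)
  ultimately have "finitely_presented G"
    unfolding finitely_presented_def using G.is_group ker by blast
  moreover have "finitely_discriminable G"
  proof (rule finitely_discriminableI[of G "\<pi> ` (D - N)"])
    have "\<pi> x \<noteq> \<one>\<^bsub>G\<^esub>" if "x \<in> D - N" for x
      using that D(2) unfolding ker[symmetric] kernel_def by blast
    then show "\<pi> ` (D - N) \<subseteq> carrier G - {\<one>\<^bsub>G\<^esub>}"
      using D(2) by auto
    fix V assume V: "V \<lhd> G" "V \<noteq> {\<one>\<^bsub>G\<^esub>}"
    interpret V: normal V G by fact
    let ?M = "{x \<in> carrier ?F. \<pi> x \<in> V}"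
    have "N \<subseteq> ?M"
      unfolding ker[symmetric] kernel_def by auto
    have "\<not> V \<subseteq> {\<one>\<^bsub>G\<^esub>}"
      using V(2) V.one_closed by blast
    then obtain v where v: "v \<in> V" "v \<noteq> \<one>\<^bsub>G\<^esub>"
      by blast
    then have "v \<in> \<pi> ` carrier ?F"
      using surj V.subset by blast
    then obtain x where x: "v = \<pi> x" "x \<in> carrier ?F"
      by (rule imageE)
    have "x \<in> ?M"
      using x v(1) by simp
    moreover have "x \<notin> N"
      unfolding ker[symmetric] kernel_def using x(1) v(2) by simp
    ultimately have "?M \<noteq> N"
      by blast
    then have "?M \<inter> D \<noteq> N \<inter> D"
      using D(3)[OF \<pi>.normal_preimage[OF V(1)]] by blast
    then obtain d where "d \<in> D" "d \<in> ?M" "d \<notin> N"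
      using \<open>N \<subseteq> ?M\<close> by blast
    then show "V \<inter> \<pi> ` (D - N) \<noteq> {}"
      by blast
  qed (simp_all add: G.is_group D(1))
  ultimately show "finitely_presented G \<and> finitely_discriminable G" ..
next
  assume G: "finitely_presented G \<and> finitely_discriminable G"
  then interpret G: group G
    by (simp add: finitely_presented_def)
  obtain m \<pi> where \<pi>: "\<pi> \<in> epi (free_group m) G"
      "finitely_normally_generated (free_group m) (kernel (free_group m) G \<pi>)"
    using G by (auto simp: finitely_presented_def)
  let ?F = "free_group m"
  have \<pi>': "\<pi> \<in> hom ?F G" "\<pi> ` carrier ?F = carrier G"
    using \<pi>(1) by (auto simp: epi_def)
  interpret \<pi>: group_hom ?F G \<pi>
    by (simp add: group_hom_def group_hom_axioms_def G.is_group group_free_group \<pi>')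
  define N where "N = kernel ?F G \<pi>"
  interpret N: normal N ?F
    unfolding N_def by (rule \<pi>.normal_kernel)
  obtain A where A: "finite A" "A \<subseteq> N" "\<And>M. M \<lhd> ?F \<Longrightarrow> A \<subseteq> M \<Longrightarrow> N \<subseteq> M"
    by (rule finitely_normally_generatedE[OF \<pi>(2)[folded N_def]]) (rule that)
  obtain B where B: "finite B" "B \<subseteq> carrier G - {\<one>\<^bsub>G\<^esub>}"
      "\<And>V. V \<lhd> G \<Longrightarrow> V \<noteq> {\<one>\<^bsub>G\<^esub>} \<Longrightarrow> V \<inter> B \<noteq> {}"
    by (rule finitely_discriminableE[OF conjunct2[OF G]]) (rule that)
  have "B \<subseteq> \<pi> ` carrier ?F"
    using B(2) \<pi>'(2) by blast
  then obtain B' where B': "B' \<subseteq> carrier ?F" "finite B'" "B = \<pi> ` B'"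
    using finite_subset_image[OF B(1)] by blast
  have "M = N" if M: "M \<lhd> ?F" "M \<inter> (A \<union> B') = N \<inter> (A \<union> B')" for M
  proof
    interpret M: normal M ?F by fact
    show "N \<subseteq> M"
      by (rule A(3)[OF M(1)]) (use M(2) A(2) in blast)
    \<comment> \<open>Otherwise the image of \<open>M\<close> contains some \<open>\<pi> b\<close> with \<open>b \<in> B'\<close>; then \<open>b \<in> M\<close> as
      \<open>M\<close> contains the kernel, so \<open>b \<in> N\<close> by the choice of the determining set.\<close>
    have "\<pi> ` M = {\<one>\<^bsub>G\<^esub>}"
    proof (rule ccontr)
      assume "\<pi> ` M \<noteq> {\<one>\<^bsub>G\<^esub>}"
      moreover have "\<pi> ` M \<lhd> G"
        by (rule M.surj_hom_normal_subgroup[OF \<pi>.group_hom_axioms \<pi>'(2)])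
      ultimately have "\<pi> ` M \<inter> B \<noteq> {}"
        by (intro B(3))
      then obtain x b where xb: "x \<in> M" "b \<in> B'" "\<pi> x = \<pi> b"
        using B'(3) by auto
      have c: "x \<in> carrier ?F" "b \<in> carrier ?F"
        using xb(1,2) B'(1) by auto
      have "\<pi> (b \<otimes>\<^bsub>?F\<^esub> inv\<^bsub>?F\<^esub> x) = \<one>\<^bsub>G\<^esub>"
        using c by (simp add: xb(3))
      then have "b \<otimes>\<^bsub>?F\<^esub> inv\<^bsub>?F\<^esub> x \<in> N"
        unfolding N_def kernel_def using \<pi>.G.m_closed[OF c(2) \<pi>.G.inv_closed[OF c(1)]] by blast
      then have "b \<otimes>\<^bsub>?F\<^esub> inv\<^bsub>?F\<^esub> x \<otimes>\<^bsub>?F\<^esub> x \<in> M"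
        by (rule M.m_closed[OF subsetD[OF \<open>N \<subseteq> M\<close>] xb(1)])
      then have "b \<in> M"
        using c by (simp add: \<pi>.G.m_assoc)
      then have "b \<in> N"
        using M(2) xb(2) by blast
      then have "\<pi> b = \<one>\<^bsub>G\<^esub>"
        unfolding N_def kernel_def by blast
      then show False
        using B(2) B'(3) xb(2) by auto
    qed
    then show "M \<subseteq> N"
      unfolding N_def kernel_def using M.subset by blast
  qed
  moreover have "finite (A \<union> B')" "A \<union> B' \<subseteq> carrier ?F"
    using A(1,2) B'(1,2) N.subset by auto
  ultimately have "openin (normal_subgroups_topology ?F) {N}"
    unfolding \<pi>.G.open_normal_subgroup_singleton_iff using N.normal_axioms by blast
  moreover have "?F Mod N \<cong> G"
    unfolding N_def by (rule \<pi>.FactGroup_iso[OF \<pi>'(2)])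
  ultimately show "isolated_group G"
    unfolding isolated_group_def
    using N.normal_axioms finitely_presented_imp_finitely_generated[OF conjunct1[OF G]] by blast
qed

theorem theorem7:
  fixes K :: "('k, 'c) monoid_scheme" and G :: "('a, 'b) monoid_scheme"
    and Q :: "('q, 'd) monoid_scheme" and i :: "'k \<Rightarrow> 'a" and p :: "'a \<Rightarrow> 'q" and H :: "'a set"
  shows
    "(short_exact_sequence K i G p Q \<longrightarrow>
        (finitely_discriminable K \<and> finitely_discriminable Q \<longrightarrow> finitely_discriminable G) \<and>
        (isolated_group K \<and> isolated_group Q \<longrightarrow> isolated_group G)) \<and>
     (group G \<and> subgroup H G \<and> finite (rcosets\<^bsub>G\<^esub> H) \<longrightarrow>
        (finitely_discriminable (G\<lparr>carrier := H\<rparr>) \<longrightarrow> finitely_discriminable G) \<and>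
        (isolated_group (G\<lparr>carrier := H\<rparr>) \<longrightarrow> isolated_group G))"
proof -
  have extension: "(finitely_discriminable K \<and> finitely_discriminable Q \<longrightarrow> finitely_discriminable G) \<and>
      (isolated_group K \<and> isolated_group Q \<longrightarrow> isolated_group G)"
    if ses: "short_exact_sequence K i G p Q"
    unfolding isolated_group_iff_finitely_presented_finitely_discriminable
    using finitely_discriminable_extension[OF ses] finitely_presented_extension[OF ses] by blast
  have overgroup: "(finitely_discriminable (G\<lparr>carrier := H\<rparr>) \<longrightarrow> finitely_discriminable G) \<and>
      (isolated_group (G\<lparr>carrier := H\<rparr>) \<longrightarrow> isolated_group G)"
    if G: "group G" and H: "subgroup H G" "finite (rcosets\<^bsub>G\<^esub> H)"
    unfolding isolated_group_iff_finitely_presented_finitely_discriminable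
    using group.finitely_discriminable_overgroup[OF G H] group.finitely_presented_overgroup[OF G H]
    by blast
  show ?thesis
    using extension overgroup by blast
qed

end
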